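(* Let $S_E(\lambda_E(t))$ be the ego set and $\overline{S}(\lambda(t))$ the unsafe set described in the context, where the ego parameters evolve according to $\dot{\lambda}_E=f(\lambda_E)+g(\lambda_E)u$ with $u=u^*(\lambda_E(t))$. Let $u^*(\lambda_E(t))$ be any Lipschitz continuous controller such that $u^*(\lambda_E(t))\in K(\lambda_E(t),\lambda(t))$ for all $t\in[t_0,t_1)$. If $S_E(\lambda_E(t_0))\cap\overline{S}(\lambda(t_0))=\emptyset$, then $S_E(\lambda_E(t))\cap\overline{S}(\lambda(t))=\emptyset$ for all $t\in[t_0,t_1]$.
   Context: For $\epsilon>0$ and $x\in\mathbb{R}^q$, $\mathrm{LSE}_\epsilon^+(x)=\frac1\epsilon\log\left(1+\sum_{i=1}^q e^{\epsilon x_i}\right)$. Fix $\epsilon>0$. Standard conditions. A set-valued map $S':\mathbb{R}^{M'}\to2^{\mathbb{R}^N}$ satisfies the standard conditions if: (1) $S'(\lambda')$ is convex, compact and has nonempty interior for all $\lambda'\in\mathbb{R}^{M'}$; (2) there are functions $F^k:\mathbb{R}^N\times\mathbb{R}^{M'}\to\mathbb{R}$, $k=1,\dots,n_F$, $n_F\ge1$, convex in their first argument $x$ and parameterized by $\lambda'$, with $S'(\lambda')=\{x: F^k(x,\lambda')\le0\ \forall k=1,\dots,n_F\}$; (3) the functions $\partial F^k/\partial x$ are continuously differentiable in $\lambda'$ and twice continuously differentiable in $x$. Setting. The state space $\mathbb{R}^N$ is divided into a parametric safe set $S(\lambda(t))$ and unsafe set $\overline{S}(\lambda(t))=\mathbb{R}^N\setminus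 S(\lambda(t))$. Here $\lambda=(\lambda_1,\dots,\lambda_J)$, $\lambda_j(t)\in\mathbb{R}^{M_j}$, is a possibly time-varying parameter vector with time derivatives $\dot\lambda_j$, and $\overline{S}(\lambda)\subseteq\bigcup_{j=1}^J\mathrm{cl}(\overline{S}_j(\lambda_j))$ for all $\lambda$, for given set-valued maps $\overline{S}_j:\mathbb{R}^{M_j}\to2^{\mathbb{R}^N}$ ($\mathrm{cl}$ denotes closure). The ego set is $S_E(\lambda_E)$, with $S_E:\mathbb{R}^{M_E}\to2^{\mathbb{R}^N}$ and $\lambda_E(t)\in\mathbb{R}^{M_E}$. The maps $f:\mathbb{R}^{M_E}\to\mathbb{R}^{M_E}$ and $g:\mathbb{R}^{M_E}\to\mathbb{R}^{M_E\times P_E}$ are locally Lipschitz; controls $u$ take values in $\mathbb{R}^{P_E}$. Assumptions. $S_E$ and all $\overline{S}_j$ satisfy the standard conditions, with associated vectors of functions $F_E=(F_E^1,\dots,F_E^{n_{F_E}})$ and $F_j=(F_j^1,\dots,F_j^{n_{F_j}})$. The matrices $\partial F_E(x,\lambda_E)/\partial x$ and $\partial F_j(x,\lambda_j)/\partial x$ have full column rank for all $x\in\mathbb{R}^N$, $\lambda_E\in\mathbb{R}^{M_E}$, $\lambda_j\in\mathbb{R}^{M_j}$. Overapproximated distance. Let $(S_E)_\epsilon^+(\lambda_E)=\{x:\mathrm{LSE}_\epsilon^+(F_E(x,\lambda_E))\le\frac{\log(n_{F_E})}{\epsilon}\}$, $(\overline{S}_j)_\epsilon^+(\lambda_j)=\{x:\mathrm{LSE}_\epsilon^+(F_j(x,\lambda_j))\le\frac{\log(n_{F_j})}{\epsilon}\}$,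 and $$d_\epsilon^+(\lambda_E,\lambda_j)=\min\left\{\tfrac12\|z_E-z_j\|_2^2:\ z_E\in(S_E)_\epsilon^+(\lambda_E),\ z_j\in(\overline{S}_j)_\epsilon^+(\lambda_j)\right\}.$$ For a specified safety distance $R>0$ let $h_j(\lambda_E,\lambda_j)=d_\epsilon^+(\lambda_E,\lambda_j)-R$. Admissible controls. Let $\alpha_1,\dots,\alpha_J:\mathbb{R}\to\mathbb{R}$ be locally Lipschitz extended class-$\mathcal{K}$ functions (strictly increasing, with $\alpha_j(0)=0$). Then $K(\lambda_E,\lambda)$ is the set of all $u\in\mathbb{R}^{P_E}$ such that for every $j=1,\dots,J$ $$\frac{\partial h_j}{\partial\lambda_E}\left(f(\lambda_E)+g(\lambda_E)u\right)+\frac{\partial h_j}{\partial\lambda_j}\dot\lambda_j\ \ge\ -\alpha_j(h_j(\lambda_E,\lambda_j)).$$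
   Formalization: The overapproximating sets use the level log(n+1)/ε instead of log(n)/ε (with the printed level they need not contain the sets and the claim fails), and the standard conditions also require each F^k itself to be continuously differentiable in λ'. *)

theory Defs
  imports "HOL-Analysis.Analysis"
begin

primrec Ck :: "nat \<Rightarrow> ('a::euclidean_space \<Rightarrow> 'b::real_normed_vector) \<Rightarrow> bool" where
  "Ck 0 f \<longleftrightarrow> continuous_on UNIV f"
| "Ck (Suc k) f \<longleftrightarrow>
     (\<forall>x. f differentiable (at x)) \<and> (\<forall>v. Ck k (\<lambda>x. frechet_derivative f (at x) v))"

definition loc_lipschitz :: "('a::metric_space \<Rightarrow> 'b::metric_space) \<Rightarrow> bool" where
  "loc_lipschitz f \<longleftrightarrow> local_lipschitz (UNIV :: real set) UNIV (\<lambda>_. f)"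

text \<open>A vector of functions \<open>F = (F 1, \<dots>, F n)\<close> is a family \<open>F k x l\<close> with \<open>k\<close> in \<open>{1..n}\<close>,
  state \<open>x\<close> and parameter \<open>l\<close>. Row \<open>k\<close> of the Jacobian of \<open>F\<close> in \<open>x\<close> is \<open>grad_x F k x l\<close>.\<close>

definition grad_x ::
  "(nat \<Rightarrow> real^'n \<Rightarrow> 'l \<Rightarrow> real) \<Rightarrow> nat \<Rightarrow> real^'n \<Rightarrow> 'l \<Rightarrow> real^'n" where
  "grad_x F k x l = (\<chi> i. frechet_derivative (\<lambda>y. F k y l) (at x) (axis i 1))"

text \<open>Regularity in the parameter and in the state is separate: one argument varies while the
  other is fixed. The clause \<open>Ck 1 (\<lambda>l. F k x l)\<close> has to be stated next to the one on the gradient: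
  a discontinuous function of \<open>l\<close> added to \<open>F k x l\<close> leaves \<open>grad_x F k x l\<close> unchanged.\<close>

definition standard_conditions ::
  "('l::euclidean_space \<Rightarrow> (real^'n) set) \<Rightarrow> nat \<Rightarrow> (nat \<Rightarrow> real^'n \<Rightarrow> 'l \<Rightarrow> real) \<Rightarrow> bool" where
  "standard_conditions S n F \<longleftrightarrow>
     (\<forall>l. convex (S l) \<and> compact (S l) \<and> interior (S l) \<noteq> {}) \<and>
     n \<ge> 1 \<and>
     (\<forall>k\<in>{1..n}. \<forall>l. convex_on UNIV (\<lambda>x. F k x l)) \<and>
     (\<forall>l. S l = {x. \<forall>k\<in>{1..n}. F k x l \<le> 0}) \<and>
     (\<forall>k\<in>{1..n}.
        (\<forall>x l. (\<lambda>y. F k y l) differentiable (at x)) \<and>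
        (\<forall>x. Ck 1 (\<lambda>l. F k x l)) \<and>
        (\<forall>x. Ck 1 (\<lambda>l. grad_x F k x l)) \<and>
        (\<forall>l. Ck 2 (\<lambda>x. grad_x F k x l)))"

text \<open>The rank is the dimension of the row space, as for the library constant \<open>rank\<close>, which is not
  applicable because the number \<open>n\<close> of rows is not a type.\<close>

definition full_column_rank :: "nat \<Rightarrow> (nat \<Rightarrow> real^'n \<Rightarrow> 'l \<Rightarrow> real) \<Rightarrow> bool" where
  "full_column_rank n F \<longleftrightarrow> (\<forall>x l. dim ((\<lambda>k. grad_x F k x l) ` {1..n}) = CARD('n))"

definition LSEp :: "real \<Rightarrow> nat \<Rightarrow> (nat \<Rightarrow> real) \<Rightarrow> real" where
  "LSEp eps q y = ln (1 + (\<Sum>i=1..q. exp (eps * y i))) / eps"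

text \<open>The level \<open>ln (n + 1) / eps\<close> is the maximum of \<open>LSEp eps n\<close> on vectors with nonpositive entries,
  so the sublevel set contains \<open>{x. \<forall>k\<in>{1..n}. F k x l \<le> 0}\<close>; equivalently, it is the set where
  \<open>ln (\<Sum>k=1..n. exp (eps * F k x l)) / eps \<le> ln n / eps\<close>. With the level \<open>ln n / eps\<close> for \<open>LSEp\<close>
  it would be empty for \<open>n = 1\<close> and would not be an overapproximation for \<open>n = 2\<close>.\<close>

definition overapprox ::
  "real \<Rightarrow> nat \<Rightarrow> (nat \<Rightarrow> real^'n \<Rightarrow> 'l \<Rightarrow> real) \<Rightarrow> 'l \<Rightarrow> (real^'n) set" where
  "overapprox eps n F l = {x. LSEp eps n (\<lambda>k. F k x l) \<le> ln (real n + 1) / eps}"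

lemma overapprox_superset:
  assumes "eps > 0"
  shows "{x. \<forall>k\<in>{1..n}. F k x l \<le> 0} \<subseteq> overapprox eps n F l"
proof
  fix x assume "x \<in> {x. \<forall>k\<in>{1..n}. F k x l \<le> 0}"
  then have "(\<Sum>k=1..n. exp (eps * F k x l)) \<le> (\<Sum>k=1..n. 1)"
    using assms by (intro sum_mono) (auto simp: mult_le_0_iff)
  then have "1 + (\<Sum>k=1..n. exp (eps * F k x l)) \<le> real n + 1" by simp
  moreover have "0 < 1 + (\<Sum>k=1..n. exp (eps * F k x l))"
    by (intro add_pos_nonneg sum_nonneg) auto
  ultimately show "x \<in> overapprox eps n F l"
    using assms by (simp add: overapprox_def LSEp_def divide_right_mono)
qed

definition overapprox_dist ::
  "real \<Rightarrow> nat \<Rightarrow> (nat \<Rightarrow> real^'n \<Rightarrow> 'e \<Rightarrow> real) \<Rightarrow> nat \<Rightarrow> (nat \<Rightarrow> real^'n \<Rightarrow> 'm \<Rightarrow> real)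
     \<Rightarrow> 'e \<Rightarrow> 'm \<Rightarrow> real" where
  "overapprox_dist eps nE FE n F lE l =
     Inf {(1/2) * (norm (zE - z))\<^sup>2 | zE z. zE \<in> overapprox eps nE FE lE \<and> z \<in> overapprox eps n F l}"

definition barrier ::
  "real \<Rightarrow> real \<Rightarrow> nat \<Rightarrow> (nat \<Rightarrow> real^'n \<Rightarrow> 'e \<Rightarrow> real) \<Rightarrow>
     ('j \<Rightarrow> nat) \<Rightarrow> ('j \<Rightarrow> nat \<Rightarrow> real^'n \<Rightarrow> 'm \<Rightarrow> real) \<Rightarrow> 'j \<Rightarrow> 'e \<Rightarrow> 'm \<Rightarrow> real" where
  "barrier eps R nE FE n F j lE l = overapprox_dist eps nE FE (n j) (F j) lE l - R"

text \<open>The parameter blocks \<open>\<lambda>\<^sub>j\<close>, whose dimensions may differ, are the parts of one concatenated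
  vector \<open>l :: real^'m\<close>: coordinate \<open>i\<close> belongs to block \<open>own i\<close>, and block \<open>j\<close> has as many entries as
  there are \<open>i\<close> with \<open>own i = j\<close>. A map of \<open>\<lambda>\<^sub>j\<close> is a map of \<open>l\<close> that factors through \<open>block own j\<close>.\<close>

definition block :: "('m \<Rightarrow> 'j) \<Rightarrow> 'j \<Rightarrow> real^'m \<Rightarrow> real^'m" where
  "block own j l = (\<chi> i. if own i = j then l $ i else 0)"

definition extended_class_K :: "(real \<Rightarrow> real) \<Rightarrow> bool" where
  "extended_class_K a \<longleftrightarrow> strict_mono a \<and> a 0 = 0"

text \<open>\<open>dl\<close> is the time derivative of the parameter vector \<open>l\<close>. Applied to \<open>block own j dl\<close>, the
  derivative in \<open>l\<close> is the partial derivative in \<open>\<lambda>\<^sub>j\<close> applied to the time derivative of \<open>\<lambda>\<^sub>j\<close>.\<close>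

definition admissible_controls ::
  "('m::finite \<Rightarrow> 'j) \<Rightarrow> ('j \<Rightarrow> real^'e \<Rightarrow> real^'m \<Rightarrow> real) \<Rightarrow> (real^'e \<Rightarrow> real^'e) \<Rightarrow>
     (real^'e \<Rightarrow> real^'p^'e) \<Rightarrow> ('j \<Rightarrow> real \<Rightarrow> real) \<Rightarrow> real^'e \<Rightarrow> real^'m \<Rightarrow> real^'m \<Rightarrow> (real^'p) set" where
  "admissible_controls own h f g \<alpha> lE l dl =
     {u. \<forall>j. frechet_derivative (\<lambda>m. h j m l) (at lE) (f lE + g lE *v u)
             + frechet_derivative (\<lambda>m. h j lE m) (at l) (block own j dl)
           \<ge> - \<alpha> j (h j lE l)}"

end

theory Submission
  imports Defs
begin

text \<open>Let \<open>d\<^sub>j\<close> be half the squared distance of the overapproximations of the ego set and of the \<open>j\<close>-th unsafe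
  set, and \<open>h\<^sub>j = d\<^sub>j - R\<close>. The overapproximations contain the sets, so it suffices that \<open>d\<^sub>j > 0\<close>,
  that is \<open>h\<^sub>j > - R\<close>, along the trajectory.

  Granted that \<open>d\<^sub>j\<close> is differentiable, this is a comparison argument. At a time before \<open>t\<^sub>1\<close> with
  \<open>d\<^sub>j = 0\<close> the nonnegative function \<open>d\<^sub>j\<close> has a minimum, its derivative is \<open>0\<close>, and admissibility would
  give \<open>0 \<ge> - \<alpha> (- R) > 0\<close>. Hence \<open>d\<^sub>j > 0\<close> on \<open>[t\<^sub>0, t\<^sub>1)\<close>. If \<open>h\<^sub>j\<close> is negative at \<open>t\<^sub>1\<close>, it is negative
  shortly before, admissibility makes it nondecreasing there, and its value at \<open>t\<^sub>1\<close> is still above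
  \<open>- R\<close> (\<open>overapprox_dist_remains_positive\<close>). When \<open>t\<^sub>0 = t\<^sub>1\<close> the claim is the hypothesis on the initial state.

  The work lies in the differentiability of \<open>d\<^sub>j\<close>, jointly in both parameters. Joint differentiability
  turns the sum of the two partial derivatives into the rate of change along the trajectory. The overapproximation is
  the sublevel set of the convex function \<open>G x l = (\<Sum>k. exp (eps * F k x l)) - n\<close>. The
  gradients of the constraints span the space, so \<open>G\<close> grows quadratically around every point, uniformly
  for nearby parameters (\<open>G_growth\<close>). Consequently a supporting hyperplane of the body, with a
  fixed normal, and its point of contact move differentiably with the parameter, although \<open>G\<close> is regular only
  separately in \<open>x\<close> and \<open>l\<close> (\<open>support_point_moves_smoothly\<close>). For two disjoint bodies the slab between
  the hyperplanes at the closest points bounds the distance from below and the contact points bound it from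
  above, with equal first-order terms (\<open>gap_differentiable\<close>). For bodies that meet, the distance is
  \<open>O(\<delta>)\<close> under a parameter change of size \<open>\<delta>\<close>, so \<open>d\<^sub>j\<close> is \<open>O(\<delta>\<^sup>2)\<close>
  (\<open>half_gap_squared_derivative_at_contact\<close>).\<close>

section \<open>First-order estimates near a point\<close>

lemma differentiable_linear_bound:
  fixes f :: "'a::real_normed_vector \<Rightarrow> 'b::real_normed_vector"
  assumes "f differentiable (at x)"
  obtains L where "0 < L" "\<forall>\<^sub>F y in nhds x. norm (f y - f x) \<le> L * norm (y - x)"
proof -
  obtain f' where f': "(f has_derivative f') (at x)"
    using assms unfolding differentiable_def by blast
  then interpret bounded_linear f' by (rule has_derivative_bounded_linear)
  obtain K where K: "0 < K" "\<And>v. norm (f' v) \<le> norm v * K"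
    using pos_bounded by blast
  obtain d where d: "0 < d"
    "\<And>y. norm (y - x) < d \<Longrightarrow> norm (f y - f x - f' (y - x)) \<le> 1 * norm (y - x)"
    using f' unfolding has_derivative_at_alt by (metis zero_less_one)
  have "norm (f y - f x) \<le> (K + 1) * norm (y - x)" if "norm (y - x) < d" for y
    using d(2)[OF that] K(2)[of "y - x"] norm_triangle_sub[of "f y - f x" "f' (y - x)"]
    by (simp add: algebra_simps)
  then have "\<forall>\<^sub>F y in nhds x. norm (f y - f x) \<le> (K + 1) * norm (y - x)"
    unfolding eventually_nhds_metric using d(1) by (auto simp: dist_norm)
  then show thesis using K(1) that[of "K + 1"] by simp
qed

lemma has_derivative_eventually:
  assumes "(f has_derivative f') (at x)" "0 < e"
  shows "\<forall>\<^sub>F y in nhds x. norm (f y - f x - f' (y - x)) \<le> e * norm (y - x)"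
  using assms unfolding has_derivative_at_alt eventually_nhds_metric dist_norm by blast

lemma has_derivative_eventuallyI:
  assumes "bounded_linear f'"
    and "\<And>e. 0 < e \<Longrightarrow> \<forall>\<^sub>F y in nhds x. norm (f y - f x - f' (y - x)) \<le> e * norm (y - x)"
  shows "(f has_derivative f') (at x)"
  unfolding has_derivative_within_alt2 using assms filter_leD[OF at_within_le_nhds] by blast

lemma eventually_norm_diff_less:
  fixes x :: "'a::real_normed_vector"
  assumes "0 < e"
  shows "\<forall>\<^sub>F y in nhds x. norm (y - x) < e"
  using assms unfolding eventually_nhds_metric dist_norm by blast

section \<open>Convex bodies that depend on a parameter\<close>

text \<open>The body at parameter \<open>l\<close> is the sublevel set \<open>{x. G x l \<le> 0}\<close>. Regularity in \<open>x\<close> and in \<open>l\<close> is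
  separate. The assumption \<open>quadratic_growth\<close> makes this enough: it expands \<open>G\<close> at a
  fixed point \<open>x0\<close>, where the slope \<open>a l\<close> may move with \<open>l\<close> but the modulus \<open>m\<close> and the radius \<open>r\<close> may not.
  A change of slope of order
  \<open>norm (l - l0)\<close> then changes minima near \<open>x0\<close> only by the square of that order.\<close>

locale moving_convex_body =
  fixes G :: "'a::euclidean_space \<Rightarrow> 'l::real_normed_vector \<Rightarrow> real"
  assumes convex_in_state: "convex_on UNIV (\<lambda>x. G x l)"
    and differentiable_in_parameter: "G x differentiable (at l)"
    and quadratic_growth: "\<exists>a m r. a differentiable (at l0) \<and> 0 < m \<and> 0 < r \<and>
          ((\<lambda>x. G x l0) has_derivative (\<lambda>v. a l0 \<bullet> v)) (at x0) \<and>
          (\<forall>\<^sub>F l in nhds l0. \<forall>v. norm v \<le> r \<longrightarrow> G x0 l + a l \<bullet> v + m * (norm v)\<^sup>2 \<le> G (x0 + v) l)"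
    and bounded_sublevel: "bounded {x. G x l \<le> 0}"
    and strictly_feasible: "\<exists>x. G x l < 0"
begin

definition body :: "'l \<Rightarrow> 'a set" where
  "body l = {x. G x l \<le> 0}"

lemma compact_body: "compact (body l)"
proof -
  have "continuous_on UNIV (\<lambda>x. G x l)"
    using convex_on_continuous[OF open_UNIV convex_in_state] .
  then have "closed {x. G x l \<le> 0}"
    by (intro closed_Collect_le continuous_on_const)
  then show ?thesis
    using bounded_sublevel unfolding body_def by (simp add: compact_eq_bounded_closed)
qed

lemma body_nonempty: "body l \<noteq> {}"
  using strictly_feasible[of l] unfolding body_def by (auto intro: less_imp_le)

lemma G_segment:
  assumes "0 \<le> t" "t \<le> 1"
  shows "G (x + t *\<^sub>R v) l \<le> (1 - t) * G x l + t * G (x + v) l"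
  using convex_onD[OF convex_in_state assms, of x "x + v" l]
  by (simp add: algebra_simps)

lemma convex_body: "convex (body l)"
proof (rule convexI)
  fix x y :: 'a and s t :: real
  assume xy: "x \<in> body l" "y \<in> body l" and st: "0 \<le> s" "0 \<le> t" "s + t = 1"
  have "G (s *\<^sub>R x + t *\<^sub>R y) l \<le> s * G x l + t * G y l"
    using convex_in_state[of l] st unfolding convex_on_def by blast
  also have "\<dots> \<le> 0"
    using xy st by (intro add_nonpos_nonpos mult_nonneg_nonpos) (auto simp: body_def)
  finally show "s *\<^sub>R x + t *\<^sub>R y \<in> body l" by (simp add: body_def)
qed

lemma tendsto_G: "(G x \<longlongrightarrow> G x l) (nhds l)"
  using differentiable_imp_continuous_within[OF differentiable_in_parameter[of x l]]
  by (simp add: continuous_within tendsto_at_iff_tendsto_nhds)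

text \<open>Convexity along the ray through \<open>x + v\<close> carries the growth from the sphere of radius \<open>r\<close> outwards,
  where it remains at least linear.\<close>

lemma quadratic_growth_extends:
  assumes loc: "\<And>v. norm v \<le> r \<Longrightarrow> G x l + a \<bullet> v + m * (norm v)\<^sup>2 \<le> G (x + v) l"
    and "0 < r" "0 < m"
  shows "G x l + a \<bullet> v + m * norm v * min (norm v) r \<le> G (x + v) l"
proof (cases "norm v \<le> r")
  case True
  then show ?thesis using loc[OF True] by (simp add: power2_eq_square algebra_simps)
next
  case False
  define s where "s = r / norm v"
  have v: "norm v > 0" "r < norm v" using False \<open>0 < r\<close> by linarith+
  have s: "0 < s" "s \<le> 1" "s * norm v = r"
    using v \<open>0 < r\<close> by (auto simp: s_def)
  have "G x l + a \<bullet> (s *\<^sub>R v) + m * (norm (s *\<^sub>R v))\<^sup>2 \<le> G (x + s *\<^sub>R v) l"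
    by (rule loc) (use s in simp)
  also have "\<dots> \<le> (1 - s) * G x l + s * G (x + v) l"
    using s by (intro G_segment) auto
  finally have "s * (G x l + a \<bullet> v) + m * (s * norm v) * r \<le> s * G (x + v) l"
    using s by (simp add: algebra_simps power2_eq_square)
  then have "s * (G x l + a \<bullet> v + m * norm v * r) \<le> s * G (x + v) l"
    by (simp add: algebra_simps)
  then show ?thesis using s v by simp
qed

text \<open>Moving \<open>x0\<close> a fraction of order \<open>norm (l - l0)\<close> of the way to a strictly feasible point lowers \<open>G\<close>
  by as much as the change of parameter may have raised it.\<close>

lemma nearby_point_persists:
  assumes "x0 \<in> body l0"
  obtains C where "0 < C" "\<forall>\<^sub>F l in nhds l0. \<exists>x\<in>body l. norm (x - x0) \<le> C * norm (l - l0)"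
proof -
  obtain xb where xb: "G xb l0 < 0" using strictly_feasible by blast
  define \<kappa> where "\<kappa> = - G xb l0 / 2"
  have \<kappa>: "0 < \<kappa>" "G xb l0 < - \<kappa>" using xb by (auto simp: \<kappa>_def)
  obtain L where L: "0 < L" "\<forall>\<^sub>F l in nhds l0. norm (G x0 l - G x0 l0) \<le> L * norm (l - l0)"
    using differentiable_linear_bound[OF differentiable_in_parameter] by blast
  have ev1: "\<forall>\<^sub>F l in nhds l0. G xb l < - \<kappa>"
    using tendsto_G \<kappa>(2) by (rule order_tendstoD)
  have ev2: "\<forall>\<^sub>F l in nhds l0. norm (l - l0) < \<kappa> / L"
    using \<kappa>(1) L(1) by (intro eventually_norm_diff_less) simp
  define C where "C = L / \<kappa> * (norm (xb - x0) + 1)"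
  have C: "0 < C" using L(1) \<kappa>(1) unfolding C_def
    by (intro mult_pos_pos divide_pos_pos add_nonneg_pos) auto
  have "\<forall>\<^sub>F l in nhds l0. \<exists>x\<in>body l. norm (x - x0) \<le> C * norm (l - l0)"
    using L(2) ev1 ev2
  proof eventually_elim
    case (elim l)
    define t where "t = L * norm (l - l0) / \<kappa>"
    have t: "0 \<le> t" "t \<le> 1" "t * \<kappa> = L * norm (l - l0)"
      using elim L(1) \<kappa>(1) by (auto simp: t_def field_simps)
    have "G (x0 + t *\<^sub>R (xb - x0)) l \<le> (1 - t) * G x0 l + t * G xb l"
      using G_segment[OF t(1,2), of x0 "xb - x0" l] by simp
    also have "\<dots> \<le> (1 - t) * (t * \<kappa>) + t * (- \<kappa>)"
      using elim assms t by (intro add_mono mult_left_mono) (auto simp: body_def)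
    also have "\<dots> = - (t * (t * \<kappa>))" by (simp add: algebra_simps)
    also have "\<dots> \<le> 0" using t(1) \<kappa>(1) by simp
    finally have "x0 + t *\<^sub>R (xb - x0) \<in> body l" by (simp add: body_def)
    moreover have "t * norm (xb - x0) \<le> C * norm (l - l0)"
    proof -
      have "t * norm (xb - x0) \<le> t * (norm (xb - x0) + 1)" using t by (intro mult_left_mono) auto
      then show ?thesis by (simp add: t_def C_def mult_ac)
    qed
    ultimately show ?case using t(1)
      by (intro bexI[of _ "x0 + t *\<^sub>R (xb - x0)"]) auto
  qed
  then show thesis using C that by blast
qed

text \<open>This is the Lagrange condition for maximizing \<open>n \<bullet> x\<close> over the body. If \<open>G\<close> were negative
  at \<open>x0\<close>, or \<open>a\<close> not parallel to \<open>n\<close>, some direction would increase \<open>n \<bullet> x\<close> inside the body; a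
  strictly feasible point keeps \<open>a\<close> from vanishing.\<close>

lemma gradient_at_support_point:
  assumes x0: "x0 \<in> body l0" and n: "norm n = 1"
    and supp: "\<And>x. x \<in> body l0 \<Longrightarrow> n \<bullet> x \<le> n \<bullet> x0"
    and der: "((\<lambda>x. G x l0) has_derivative (\<lambda>v. a \<bullet> v)) (at x0)"
    and above: "\<And>v. G x0 l0 + a \<bullet> v \<le> G (x0 + v) l0"
  shows "G x0 l0 = 0" and "\<exists>c>0. a = c *\<^sub>R n"
proof -
  have step: "\<exists>t>0. G (x0 + t *\<^sub>R v) l0 \<le> 0" if "G x0 l0 < 0 \<or> a \<bullet> v < 0" for v
  proof (cases "G x0 l0 < 0")
    case True
    have "((\<lambda>x. G x l0) \<longlongrightarrow> G x0 l0) (nhds x0)"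
      using has_derivative_continuous[OF der] tendsto_at_iff_tendsto_nhds[of "\<lambda>x. G x l0" x0]
      by (simp add: isCont_def)
    then have "\<forall>\<^sub>F x in nhds x0. G x l0 < 0"
      using True by (rule order_tendstoD)
    then obtain d where d: "0 < d" "\<And>x. dist x x0 < d \<Longrightarrow> G x l0 < 0"
      unfolding eventually_nhds_metric by blast
    define t where "t = d / (2 * (norm v + 1))"
    have "t > 0" using d(1) by (auto simp: t_def intro!: divide_pos_pos add_nonneg_pos)
    moreover have "t * norm v < d"
    proof -
      have "t * norm v \<le> t * (norm v + 1)" using \<open>t > 0\<close> by simp
      also have "\<dots> = d / 2" by (simp add: t_def field_simps add_nonneg_eq_0_iff)
      finally show ?thesis using d(1) by simp
    qed
    ultimately show ?thesis using d(2)[of "x0 + t *\<^sub>R v"]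
      by (intro exI[of _ t]) (auto simp: dist_norm)
  next
    case False
    with that have neg: "a \<bullet> v < 0" by simp
    then have v: "norm v > 0" by auto
    define e where "e = - (a \<bullet> v) / norm v"
    have e: "0 < e" using neg v by (simp add: e_def divide_neg_pos)
    obtain d where d: "0 < d" "\<And>y. norm (y - x0) < d \<Longrightarrow>
        norm (G y l0 - G x0 l0 - a \<bullet> (y - x0)) \<le> e * norm (y - x0)"
      using der e unfolding has_derivative_at_alt by meson
    define t where "t = d / (2 * norm v)"
    have t: "0 < t" "t * norm v < d" using d(1) v by (auto simp: t_def)
    have "norm (G (x0 + t *\<^sub>R v) l0 - G x0 l0 - a \<bullet> (t *\<^sub>R v)) \<le> e * (t * norm v)"
      using d(2)[of "x0 + t *\<^sub>R v"] t by simp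
    also have "e * (t * norm v) = - (t * (a \<bullet> v))" using v by (simp add: e_def)
    finally have "G (x0 + t *\<^sub>R v) l0 \<le> G x0 l0" by (simp add: abs_le_iff)
    then show ?thesis using t x0 by (auto simp: body_def)
  qed
  show "G x0 l0 = 0"
  proof (rule ccontr)
    assume "G x0 l0 \<noteq> 0"
    then have "G x0 l0 < 0" using x0 by (simp add: body_def)
    then obtain t where "t > 0" "G (x0 + t *\<^sub>R n) l0 \<le> 0" using step by blast
    then have "n \<bullet> (x0 + t *\<^sub>R n) \<le> n \<bullet> x0" by (intro supp) (simp add: body_def)
    then show False using \<open>t > 0\<close> n by (simp add: inner_add_right dot_square_norm)
  qed
  obtain xb where "G xb l0 < 0" using strictly_feasible by blast
  then have "a \<bullet> (xb - x0) < 0" using above[of "xb - x0"] \<open>G x0 l0 = 0\<close> by simp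
  then have a: "norm a > 0" by auto
  have "n \<bullet> a = norm n * norm a"
  proof (rule ccontr)
    assume "n \<bullet> a \<noteq> norm n * norm a"
    then have lt: "n \<bullet> a < norm a" using norm_cauchy_schwarz[of n a] n by simp
    \<comment> \<open>The bisecting direction: it leaves the half-space of \<open>n\<close> while \<open>G\<close> decreases along it.\<close>
    define v where "v = norm a *\<^sub>R n - a"
    have "a \<bullet> v = norm a * (n \<bullet> a - norm a)"
      by (simp add: v_def inner_diff_right inner_commute dot_square_norm power2_eq_square
          algebra_simps)
    then have "a \<bullet> v < 0" using lt a by (simp add: mult_pos_neg)
    then obtain t where t: "t > 0" "G (x0 + t *\<^sub>R v) l0 \<le> 0" using step by blast
    then have "n \<bullet> (x0 + t *\<^sub>R v) \<le> n \<bullet> x0" by (intro supp) (simp add: body_def)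
    then have "n \<bullet> v \<le> 0" using t(1) by (simp add: inner_add_right mult_le_0_iff)
    moreover have "n \<bullet> v = norm a - n \<bullet> a"
      using n by (simp add: v_def inner_diff_right dot_square_norm)
    ultimately show False using lt by simp
  qed
  then have "a = norm a *\<^sub>R n"
    using n norm_cauchy_schwarz_eq[of n a] by simp
  then show "\<exists>c>0. a = c *\<^sub>R n" using a by blast
qed

text \<open>Only the values of \<open>G\<close> at \<open>x0\<close> decide, to first order, how the supporting hyperplane with normal
  \<open>n\<close> moves: since \<open>G\<close> has gradient \<open>c *\<^sub>R n\<close> at \<open>x0\<close>, the equation \<open>G = 0\<close> is restored by the shift
  \<open>D (l - l0) = - G' (l - l0) / c\<close> along \<open>n\<close>, where \<open>G'\<close> is the derivative of \<open>G x0\<close> at \<open>l0\<close>.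

  The upper bound says that no point of the new body lies beyond the shifted hyperplane. A point
  could gain only by moving sideways to where \<open>G\<close> has become smaller; quadratic growth
  limits this gain to second order. The last claim says that the shifted point is almost feasible. It
  uses convexity in the form that a chord of fixed length \<open>\<rho>\<close> bounds the values at distances
  below \<open>\<rho>\<close>, so that \<open>G\<close> has to be compared with \<open>G\<close> at \<open>l0\<close> only at three fixed points.\<close>

lemma support_point_moves_smoothly:
  assumes x0: "x0 \<in> body l0" and n: "norm n = 1"
    and supp: "\<And>x. x \<in> body l0 \<Longrightarrow> n \<bullet> x \<le> n \<bullet> x0"
  obtains D where "bounded_linear D"
    and "\<And>e. 0 < e \<Longrightarrow>
      \<forall>\<^sub>F l in nhds l0. \<forall>x\<in>body l. n \<bullet> (x - x0) \<le> D (l - l0) + e * norm (l - l0)"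
    and "\<And>e. 0 < e \<Longrightarrow>
      \<forall>\<^sub>F l in nhds l0. \<exists>x\<in>body l. norm (x - x0 - D (l - l0) *\<^sub>R n) \<le> e * norm (l - l0)"
proof -
  obtain a m r where a: "a differentiable (at l0)" and m: "0 < m" and r: "0 < r"
    and der: "((\<lambda>x. G x l0) has_derivative (\<lambda>v. a l0 \<bullet> v)) (at x0)"
    and growth: "\<forall>\<^sub>F l in nhds l0. \<forall>v. norm v \<le> r \<longrightarrow>
                   G x0 l + a l \<bullet> v + m * (norm v)\<^sup>2 \<le> G (x0 + v) l"
    using quadratic_growth by blast
  have growth: "\<forall>\<^sub>F l in nhds l0. \<forall>v. G x0 l + a l \<bullet> v + m * norm v * min (norm v) r \<le> G (x0 + v) l"
    using growth by eventually_elim (blast intro: quadratic_growth_extends r m)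
  have above: "G x0 l0 + a l0 \<bullet> v \<le> G (x0 + v) l0" for v
  proof -
    have "G x0 l0 + a l0 \<bullet> v + m * norm v * min (norm v) r \<le> G (x0 + v) l0"
      using eventually_nhds_x_imp_x[OF growth] by blast
    moreover have "0 \<le> m * norm v * min (norm v) r" using m r by simp
    ultimately show ?thesis by linarith
  qed
  obtain c where c: "0 < c" "a l0 = c *\<^sub>R n"
    using gradient_at_support_point(2)[OF x0 n supp der above] by blast
  have G0: "G x0 l0 = 0"
    using gradient_at_support_point(1)[OF x0 n supp der above] .
  obtain G' where G': "(G x0 has_derivative G') (at l0)"
    using differentiable_in_parameter unfolding differentiable_def by blast
  then have bl: "bounded_linear G'" by (rule has_derivative_bounded_linear)
  define D where "D v = - G' v / c" for v
  have D: "bounded_linear D"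
    unfolding D_def using bounded_linear_compose[OF bounded_linear_divide[of c] bounded_linear_minus[OF bl]]
    by simp
  have cD: "c * D v = - G' v" for v using c(1) by (simp add: D_def)
  have upper: "\<forall>\<^sub>F l in nhds l0. \<forall>x\<in>body l. n \<bullet> (x - x0) \<le> D (l - l0) + e * norm (l - l0)"
    if e: "0 < e" for e
  proof -
    obtain C where C: "0 < C" "\<forall>\<^sub>F l in nhds l0. norm (a l - a l0) \<le> C * norm (l - l0)"
      using differentiable_linear_bound[OF a] by blast
    have ev1: "\<forall>\<^sub>F l in nhds l0. norm (G x0 l - G x0 l0 - G' (l - l0)) \<le> (c * e / 2) * norm (l - l0)"
      using c(1) e by (intro has_derivative_eventually[OF G']) simp
    have ev2: "\<forall>\<^sub>F l in nhds l0. norm (l - l0) < m * r / C"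
      using m r C(1) by (intro eventually_norm_diff_less) simp
    have ev3: "\<forall>\<^sub>F l in nhds l0. norm (l - l0) < 2 * m * c * e / C\<^sup>2"
      using m c e C(1) by (intro eventually_norm_diff_less) simp
    show ?thesis
      using growth C(2) ev1 ev2 ev3
    proof eventually_elim
      case (elim l)
      show ?case
      proof
        fix x assume "x \<in> body l"
        define v where "v = x - x0"
        define \<delta> where "\<delta> = norm (l - l0)"
        have \<delta>: "0 \<le> \<delta>" "C * \<delta> \<le> m * r" "C\<^sup>2 * \<delta> \<le> 2 * m * c * e"
          using elim(4,5) C(1) by (auto simp: \<delta>_def field_simps)
        have "G (x0 + v) l \<le> 0" using \<open>x \<in> body l\<close> by (simp add: body_def v_def)
        then have 1: "G x0 l + a l \<bullet> v + m * norm v * min (norm v) r \<le> 0"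
          using elim(1) by (meson order_trans)
        have "\<bar>(a l - a l0) \<bullet> v\<bar> \<le> norm (a l - a l0) * norm v" by (rule Cauchy_Schwarz_ineq2)
        also have "\<dots> \<le> C * \<delta> * norm v"
          using elim(2) by (intro mult_right_mono) (auto simp: \<delta>_def)
        finally have 2: "a l \<bullet> v \<ge> c * (n \<bullet> v) - C * \<delta> * norm v"
          by (simp add: c(2) inner_diff_left abs_le_iff)
        have 3: "m * norm v * min (norm v) r - C * \<delta> * norm v \<ge> - (c * e / 2) * \<delta>"
        proof (cases "norm v \<le> r")
          case True
          \<comment> \<open>Complete the square in \<open>norm v\<close>: the linear loss costs at most \<open>C\<^sup>2 * \<delta>\<^sup>2 / (4 * m)\<close>.\<close>
          have "0 \<le> (2 * m * norm v - C * \<delta>)\<^sup>2" by simp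
          also have "\<dots> = 4 * m * (m * (norm v)\<^sup>2 - C * \<delta> * norm v) + C\<^sup>2 * \<delta> * \<delta>"
            by (simp add: power2_eq_square algebra_simps)
          also have "\<dots> \<le> 4 * m * (m * (norm v)\<^sup>2 - C * \<delta> * norm v) + (2 * m * c * e) * \<delta>"
            using \<delta> by (intro add_left_mono mult_right_mono) auto
          also have "\<dots> = 4 * m * (m * (norm v)\<^sup>2 - C * \<delta> * norm v + (c * e / 2) * \<delta>)"
            by (simp add: algebra_simps)
          finally have "0 \<le> m * (norm v)\<^sup>2 - C * \<delta> * norm v + (c * e / 2) * \<delta>"
            using m by (simp add: zero_le_mult_iff)
          then show ?thesis using True by (simp add: power2_eq_square algebra_simps)
        next
          case False
          have "C * \<delta> * norm v \<le> m * r * norm v" using \<delta> by (intro mult_right_mono) auto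
          moreover have "0 \<le> (c * e / 2) * \<delta>" using c e \<delta> by simp
          ultimately show ?thesis using False by (simp add: algebra_simps)
        qed
        have 4: "G x0 l \<ge> - c * D (l - l0) - (c * e / 2) * \<delta>"
          using elim(3) G0 cD[of "l - l0"] unfolding \<delta>_def real_norm_def by linarith
        have "c * (n \<bullet> v) \<le> c * (D (l - l0) + e * \<delta>)"
          using 1 2 3 4 by (simp add: algebra_simps)
        then show "n \<bullet> (x - x0) \<le> D (l - l0) + e * norm (l - l0)"
          using c(1) by (simp add: v_def \<delta>_def)
      qed
    qed
  qed
  have attained: "\<forall>\<^sub>F l in nhds l0. \<exists>x\<in>body l. norm (x - x0 - D (l - l0) *\<^sub>R n) \<le> e * norm (l - l0)"
    if e: "0 < e" for e
  proof -
    obtain K where K: "0 < K" "\<And>v. norm (D v) \<le> norm v * K"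
      using bounded_linear.pos_bounded[OF D] by blast
    \<comment> \<open>The choice for which the margin \<open>c * e\<close> equals the error \<open>\<eta> * (1 + \<bar>shift\<bar> / \<delta>)\<close> at its largest.\<close>
    define \<eta> where "\<eta> = c * e / (1 + K + e)"
    have \<eta>: "0 < \<eta>" "\<eta> * (1 + K + e) = c * e"
      using c e K by (auto simp: \<eta>_def)
    obtain d where d: "0 < d" "\<And>y. norm (y - x0) < d \<Longrightarrow>
        norm (G y l0 - G x0 l0 - a l0 \<bullet> (y - x0)) \<le> \<eta> / 2 * norm (y - x0)"
      using der \<eta>(1) unfolding has_derivative_at_alt by (meson half_gt_zero)
    define \<rho> where "\<rho> = d / 2"
    have \<rho>: "0 < \<rho>" "\<rho> < d" using d(1) by (auto simp: \<rho>_def)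
    have near: "\<forall>\<^sub>F l in nhds l0. G (x0 + (s * \<rho>) *\<^sub>R n) l - G x0 l < \<rho> * (s * c + \<eta>)"
      if s: "\<bar>s\<bar> = 1" for s
    proof -
      have dir: "a l0 \<bullet> ((s * \<rho>) *\<^sub>R n) = \<rho> * (s * c)"
        using n by (simp add: c(2) dot_square_norm)
      have "norm (G (x0 + (s * \<rho>) *\<^sub>R n) l0 - G x0 l0 - a l0 \<bullet> ((s * \<rho>) *\<^sub>R n)) \<le> \<eta> / 2 * \<rho>"
        using d(2)[of "x0 + (s * \<rho>) *\<^sub>R n"] \<rho> s n by (simp add: abs_mult)
      then have "G (x0 + (s * \<rho>) *\<^sub>R n) l0 - G x0 l0 - \<rho> * (s * c) \<le> \<eta> / 2 * \<rho>"
        unfolding dir real_norm_def by (rule abs_le_D1)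
      then have "G (x0 + (s * \<rho>) *\<^sub>R n) l0 - G x0 l0 \<le> \<rho> * (s * c + \<eta> / 2)"
        by (simp add: algebra_simps)
      also have "\<dots> < \<rho> * (s * c + \<eta>)" using \<rho>(1) \<eta>(1) by simp
      finally have "G (x0 + (s * \<rho>) *\<^sub>R n) l0 - G x0 l0 < \<rho> * (s * c + \<eta>)" .
      then show ?thesis
        by (rule order_tendstoD(2)[OF tendsto_diff[OF tendsto_G tendsto_G]])
    qed
    have ev1: "\<forall>\<^sub>F l in nhds l0. norm (G x0 l - G x0 l0 - G' (l - l0)) \<le> \<eta> * norm (l - l0)"
      using \<eta>(1) by (intro has_derivative_eventually[OF G'])
    have ev2: "\<forall>\<^sub>F l in nhds l0. norm (l - l0) < \<rho> / (K + e)"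
      using \<rho> K e by (intro eventually_norm_diff_less) simp
    show ?thesis
      using near[of 1, simplified] near[of "-1", simplified] ev1 ev2
    proof eventually_elim
      case (elim l)
      define \<delta> where "\<delta> = norm (l - l0)"
      \<comment> \<open>Stopping short of the exact shift by \<open>e * \<delta>\<close> absorbs all errors and makes the point feasible.\<close>
      define \<tau> where "\<tau> = D (l - l0) - e * \<delta>"
      define s :: real where "s = (if 0 \<le> \<tau> then 1 else -1)"
      have \<delta>: "0 \<le> \<delta>" "(K + e) * \<delta> \<le> \<rho>"
        using elim(4) K e by (auto simp: \<delta>_def field_simps)
      have "\<bar>\<tau>\<bar> \<le> \<bar>D (l - l0)\<bar> + e * \<delta>" using mult_nonneg_nonneg[of e \<delta>] e \<delta>(1) unfolding \<tau>_def by linarith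
      also have "\<dots> \<le> (K + e) * \<delta>" using K(2)[of "l - l0"] by (simp add: \<delta>_def algebra_simps)
      finally have \<tau>: "\<bar>\<tau>\<bar> \<le> (K + e) * \<delta>" .
      define t where "t = \<bar>\<tau>\<bar> / \<rho>"
      have t: "0 \<le> t" "t \<le> 1" "t * \<rho> = \<bar>\<tau>\<bar>" "s * \<bar>\<tau>\<bar> = \<tau>" "t * (s * \<rho>) = \<tau>"
        using \<tau> \<delta>(2) \<rho>(1) by (auto simp: t_def s_def)
      have slope: "G (x0 + (s * \<rho>) *\<^sub>R n) l - G x0 l \<le> \<rho> * (s * c + \<eta>)"
        using elim(1,2) by (auto simp: s_def)
      have "G (x0 + \<tau> *\<^sub>R n) l \<le> G x0 l + t * (G (x0 + (s * \<rho>) *\<^sub>R n) l - G x0 l)"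
        using G_segment[OF t(1,2), of x0 "(s * \<rho>) *\<^sub>R n" l] t(5) by (simp add: algebra_simps)
      also have "\<dots> \<le> G x0 l + t * (\<rho> * (s * c + \<eta>))"
        using slope t(1) by (intro add_left_mono mult_left_mono)
      also have "t * (\<rho> * (s * c + \<eta>)) = c * \<tau> + \<eta> * \<bar>\<tau>\<bar>"
      proof -
        have "t * (\<rho> * (s * c + \<eta>)) = c * (s * (t * \<rho>)) + \<eta> * (t * \<rho>)" by (simp add: algebra_simps)
        then show ?thesis using t by simp
      qed
      also have "G x0 l \<le> - c * D (l - l0) + \<eta> * \<delta>"
        using elim(3) G0 cD[of "l - l0"] by (simp add: \<delta>_def abs_le_iff)
      also have "\<eta> * \<bar>\<tau>\<bar> \<le> \<eta> * ((K + e) * \<delta>)" using \<tau> \<eta>(1) by (intro mult_left_mono) auto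
      finally have "G (x0 + \<tau> *\<^sub>R n) l \<le> (\<eta> * (1 + K + e) - c * e) * \<delta>"
        by (simp add: \<tau>_def algebra_simps)
      then have "x0 + \<tau> *\<^sub>R n \<in> body l" using \<eta>(2) by (simp add: body_def)
      moreover have "norm (x0 + \<tau> *\<^sub>R n - x0 - D (l - l0) *\<^sub>R n) = e * norm (l - l0)"
      proof -
        have "x0 + \<tau> *\<^sub>R n - x0 - D (l - l0) *\<^sub>R n = - (e * \<delta>) *\<^sub>R n"
          by (simp add: \<tau>_def algebra_simps)
        then show ?thesis using n e \<delta>(1) by (simp add: \<delta>_def abs_mult)
      qed
      ultimately show ?case by force
    qed
  qed
  show thesis using that[OF D upper attained] .
qed

end

section \<open>The distance of two moving convex bodies\<close>

locale two_moving_convex_bodies =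
  A: moving_convex_body G + B: moving_convex_body H
  for G :: "'a::euclidean_space \<Rightarrow> 'p::real_normed_vector \<Rightarrow> real"
    and H :: "'a \<Rightarrow> 'q::real_normed_vector \<Rightarrow> real"
begin

definition gap :: "'p \<times> 'q \<Rightarrow> real" where
  "gap pq = setdist (A.body (fst pq)) (B.body (snd pq))"

lemma gap_attained:
  obtains x y where "x \<in> A.body (fst pq)" "y \<in> B.body (snd pq)" "dist x y = gap pq"
  using setdist_compact_closed[OF A.compact_body compact_imp_closed[OF B.compact_body]
      A.body_nonempty B.body_nonempty]
  unfolding gap_def by blast

lemma gap_eq_0_iff_meet: "gap (p, q) = 0 \<longleftrightarrow> A.body p \<inter> B.body q \<noteq> {}"
  using setdist_eq_0_compact_closed[OF A.compact_body compact_imp_closed[OF B.compact_body]]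
    A.body_nonempty B.body_nonempty by (simp add: gap_def)

lemma eventually_fst_snd:
  assumes "\<forall>\<^sub>F p in nhds p0. P p" "\<forall>\<^sub>F q in nhds q0. Q q"
  shows "\<forall>\<^sub>F pq in nhds (p0, q0). P (fst pq) \<and> Q (snd pq)"
proof (rule eventually_conj)
  have "(fst \<longlongrightarrow> p0) (nhds (p0, q0))" "(snd \<longlongrightarrow> q0) (nhds (p0, q0))"
    using tendsto_fst[OF filterlim_ident, of "(p0, q0)"] tendsto_snd[OF filterlim_ident, of "(p0, q0)"]
    by simp_all
  then show "\<forall>\<^sub>F pq in nhds (p0, q0). P (fst pq)" "\<forall>\<^sub>F pq in nhds (p0, q0). Q (snd pq)"
    using assms by (auto intro: eventually_compose_filterlim)
qed

lemma gap_small_near_contact: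
  assumes "gap pq0 = 0"
  obtains C where "0 < C" "\<forall>\<^sub>F pq in nhds pq0. gap pq \<le> C * norm (pq - pq0)"
proof -
  obtain p0 q0 where pq0: "pq0 = (p0, q0)" by force
  obtain x0 where x0: "x0 \<in> A.body p0" "x0 \<in> B.body q0"
    using gap_attained[of pq0] assms pq0 by (metis dist_eq_0_iff fst_conv snd_conv)
  obtain C1 where C1: "0 < C1" "\<forall>\<^sub>F p in nhds p0. \<exists>x\<in>A.body p. norm (x - x0) \<le> C1 * norm (p - p0)"
    using A.nearby_point_persists[OF x0(1)] by blast
  obtain C2 where C2: "0 < C2" "\<forall>\<^sub>F q in nhds q0. \<exists>x\<in>B.body q. norm (x - x0) \<le> C2 * norm (q - q0)"
    using B.nearby_point_persists[OF x0(2)] by blast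
  have "\<forall>\<^sub>F pq in nhds pq0. gap pq \<le> (C1 + C2) * norm (pq - pq0)"
    using eventually_fst_snd[OF C1(2) C2(2)] unfolding pq0
  proof eventually_elim
    case (elim pq)
    then obtain x y where x: "x \<in> A.body (fst pq)" "norm (x - x0) \<le> C1 * norm (fst pq - p0)"
      and y: "y \<in> B.body (snd pq)" "norm (y - x0) \<le> C2 * norm (snd pq - q0)" by blast
    have "gap pq \<le> dist x y" unfolding gap_def using x(1) y(1) by (rule setdist_le_dist)
    also have "\<dots> \<le> norm (x - x0) + norm (y - x0)"
      using dist_triangle2[of x y x0] by (simp add: dist_norm)
    also have "\<dots> \<le> C1 * norm (pq - (p0, q0)) + C2 * norm (pq - (p0, q0))"
    proof (rule add_mono)
      show "norm (x - x0) \<le> C1 * norm (pq - (p0, q0))"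
        using order_trans[OF x(2) mult_left_mono[OF norm_fst_le[of "fst pq - p0" "snd pq - q0"]]] C1(1)
        by (simp add: minus_prod_def less_imp_le)
      show "norm (y - x0) \<le> C2 * norm (pq - (p0, q0))"
        using order_trans[OF y(2) mult_left_mono[OF norm_snd_le[of "snd pq - q0" "fst pq - p0"]]] C2(1)
        by (simp add: minus_prod_def less_imp_le)
    qed
    finally show ?case by (simp add: algebra_simps)
  qed
  then show thesis using that[of "C1 + C2"] C1(1) C2(1) by simp
qed

text \<open>The closest point property puts both bodies on the far sides of the hyperplanes through the closest
  points that are orthogonal to the segment joining them.\<close>

lemma closest_points_support:
  assumes "x0 \<in> A.body p0" "y0 \<in> B.body q0" "dist x0 y0 = gap (p0, q0)"
  shows "x \<in> A.body p0 \<Longrightarrow> (y0 - x0) \<bullet> x \<le> (y0 - x0) \<bullet> x0"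
    and "y \<in> B.body q0 \<Longrightarrow> (x0 - y0) \<bullet> y \<le> (x0 - y0) \<bullet> y0"
proof -
  have least: "dist x0 y0 \<le> dist x y" if "x \<in> A.body p0" "y \<in> B.body q0" for x y
    using setdist_le_dist[OF that] assms(3) by (simp add: gap_def)
  show "(y0 - x0) \<bullet> x \<le> (y0 - x0) \<bullet> x0" if "x \<in> A.body p0"
    using any_closest_point_dot[OF A.convex_body compact_imp_closed[OF A.compact_body] assms(1) that, of y0]
      least[OF _ assms(2)]
    by (simp add: dist_commute inner_diff_right)
  show "(x0 - y0) \<bullet> y \<le> (x0 - y0) \<bullet> y0" if "y \<in> B.body q0"
    using any_closest_point_dot[OF B.convex_body compact_imp_closed[OF B.compact_body] assms(2) that, of x0]
      least[OF assms(1)]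
    by (simp add: inner_diff_right)
qed

text \<open>Let \<open>n\<close> be the unit vector from \<open>x0\<close> to \<open>y0\<close>, a pair of closest points. The slab between the
  supporting hyperplanes at \<open>x0\<close> and \<open>y0\<close> bounds the distance from below, the shifted points
  bound it from above, and both bounds change by the same linear map up to a small error.\<close>

lemma gap_differentiable:
  assumes "0 < gap pq0"
  shows "gap differentiable (at pq0)"
proof -
  obtain p0 q0 where pq0: "pq0 = (p0, q0)" by force
  obtain x0 y0 where x0: "x0 \<in> A.body p0" and y0: "y0 \<in> B.body q0" and xy: "dist x0 y0 = gap (p0, q0)"
    using gap_attained[of pq0] pq0 by auto
  define \<rho> where "\<rho> = gap (p0, q0)"
  have \<rho>: "0 < \<rho>" "norm (y0 - x0) = \<rho>" "norm (x0 - y0) = \<rho>"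
    using assms xy pq0 by (auto simp: \<rho>_def dist_norm norm_minus_commute)
  define n where "n = (1 / \<rho>) *\<^sub>R (y0 - x0)"
  have n: "norm n = 1" "norm (- n) = 1" "y0 = x0 + \<rho> *\<^sub>R n" using \<rho> by (auto simp: n_def)
  have suppA: "n \<bullet> x \<le> n \<bullet> x0" if "x \<in> A.body p0" for x
    using closest_points_support(1)[OF x0 y0 xy that] \<rho>(1) by (simp add: n_def divide_right_mono)
  have suppB: "- n \<bullet> y \<le> - n \<bullet> y0" if "y \<in> B.body q0" for y
    using closest_points_support(2)[OF x0 y0 xy that] \<rho>(1)
    by (simp add: n_def divide_right_mono inner_diff_left)
  obtain D1 where D1: "bounded_linear D1"
    "\<And>e. 0 < e \<Longrightarrow> \<forall>\<^sub>F p in nhds p0. \<forall>x\<in>A.body p. n \<bullet> (x - x0) \<le> D1 (p - p0) + e * norm (p - p0)"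
    "\<And>e. 0 < e \<Longrightarrow> \<forall>\<^sub>F p in nhds p0. \<exists>x\<in>A.body p. norm (x - x0 - D1 (p - p0) *\<^sub>R n) \<le> e * norm (p - p0)"
    using A.support_point_moves_smoothly[OF x0 n(1) suppA] by blast
  obtain D2 where D2: "bounded_linear D2"
    "\<And>e. 0 < e \<Longrightarrow> \<forall>\<^sub>F q in nhds q0. \<forall>y\<in>B.body q. - n \<bullet> (y - y0) \<le> D2 (q - q0) + e * norm (q - q0)"
    "\<And>e. 0 < e \<Longrightarrow> \<forall>\<^sub>F q in nhds q0. \<exists>y\<in>B.body q. norm (y - y0 - D2 (q - q0) *\<^sub>R (- n)) \<le> e * norm (q - q0)"
    using B.support_point_moves_smoothly[OF y0 n(2) suppB] by blast
  define D where "D pq = - D1 (fst pq) - D2 (snd pq)" for pq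
  have D: "bounded_linear D"
    unfolding D_def
    by (intro bounded_linear_sub bounded_linear_minus bounded_linear_compose[OF D1(1)]
        bounded_linear_compose[OF D2(1)] bounded_linear_fst bounded_linear_snd)
  obtain K where K: "0 < K" "\<And>v. norm (D v) \<le> norm v * K"
    using bounded_linear.pos_bounded[OF D] by blast
  have "\<forall>\<^sub>F pq in nhds pq0. norm (gap pq - gap pq0 - D (pq - pq0)) \<le> e * norm (pq - pq0)"
    if e: "0 < e" for e
  proof -
    have e2: "0 < e / 2" using e by simp
    have "\<forall>\<^sub>F pq in nhds pq0. norm (pq - pq0) < \<rho> / K"
      using \<rho> K by (intro eventually_norm_diff_less) simp
    then show ?thesis
      using eventually_fst_snd[OF D1(2)[OF e2] D2(2)[OF e2]]
        eventually_fst_snd[OF D1(3)[OF e2] D2(3)[OF e2]]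
      unfolding pq0
    proof eventually_elim
      case (elim pq)
      define \<delta> where "\<delta> = norm (pq - (p0, q0))"
      define T where "T = D (pq - (p0, q0))"
      have T: "T = - D1 (fst pq - p0) - D2 (snd pq - q0)"
        by (simp add: T_def D_def)
      have "\<bar>T\<bar> \<le> \<delta> * K" using K(2)[of "pq - (p0, q0)"] by (simp add: T_def \<delta>_def)
      also have "\<dots> < \<rho>" using elim(1) K(1) by (simp add: \<delta>_def field_simps)
      finally have pos: "0 < \<rho> + T" by simp
      have small: "e / 2 * norm (fst pq - p0) \<le> e / 2 * \<delta>" "e / 2 * norm (snd pq - q0) \<le> e / 2 * \<delta>"
        using norm_fst_le[of "fst pq - p0" "snd pq - q0"] norm_snd_le[of "snd pq - q0" "fst pq - p0"] e
        by (auto simp: \<delta>_def minus_prod_def intro!: mult_left_mono)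
      have "\<rho> + T - e * \<delta> \<le> gap pq"
      proof -
        obtain x y where x: "x \<in> A.body (fst pq)" and y: "y \<in> B.body (snd pq)" and "dist x y = gap pq"
          using gap_attained by blast
        have "n \<bullet> (x - x0) \<le> D1 (fst pq - p0) + e / 2 * norm (fst pq - p0)"
          and "- (n \<bullet> (y - y0)) \<le> D2 (snd pq - q0) + e / 2 * norm (snd pq - q0)"
          using elim(2) x y by auto
        moreover have "n \<bullet> (y0 - x0) = \<rho>" using n(1) by (simp add: n(3) dot_square_norm)
        ultimately have "\<rho> + T - e * \<delta> \<le> n \<bullet> (y0 - x0) + n \<bullet> (y - y0) - n \<bullet> (x - x0)"
          using small T by linarith
        also have "\<dots> = n \<bullet> (y - x)" by (simp add: inner_diff_right)
        also have "\<dots> \<le> norm (y - x)" using norm_cauchy_schwarz[of n "y - x"] n(1) by simp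
        finally show ?thesis using \<open>dist x y = gap pq\<close> by (simp add: dist_norm norm_minus_commute)
      qed
      moreover have "gap pq \<le> \<rho> + T + e * \<delta>"
      proof -
        obtain x y where x: "x \<in> A.body (fst pq)"
            "norm (x - x0 - D1 (fst pq - p0) *\<^sub>R n) \<le> e / 2 * norm (fst pq - p0)"
          and y: "y \<in> B.body (snd pq)"
            "norm (y - y0 - D2 (snd pq - q0) *\<^sub>R (- n)) \<le> e / 2 * norm (snd pq - q0)"
          using elim(3) by blast
        have "y - x = (\<rho> + T) *\<^sub>R n + (y - y0 - D2 (snd pq - q0) *\<^sub>R (- n))
                - (x - x0 - D1 (fst pq - p0) *\<^sub>R n)"
          by (simp add: T n(3) algebra_simps)
        then have "norm (y - x) \<le> norm ((\<rho> + T) *\<^sub>R n)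
            + norm (y - y0 - D2 (snd pq - q0) *\<^sub>R (- n)) + norm (x - x0 - D1 (fst pq - p0) *\<^sub>R n)"
          by (simp only:) (rule order_trans[OF norm_triangle_ineq4 add_right_mono[OF norm_triangle_ineq]])
        also have "\<dots> \<le> \<rho> + T + e * \<delta>" using x(2) y(2) small pos n(1) by simp
        finally have "norm (y - x) \<le> \<rho> + T + e * \<delta>" .
        then show ?thesis
          using setdist_le_dist[OF x(1) y(1)] by (simp add: gap_def dist_norm norm_minus_commute)
      qed
      ultimately show ?case by (simp add: \<rho>_def \<delta>_def T_def abs_le_iff)
    qed
  qed
  then have "(gap has_derivative D) (at pq0)"
    using D by (intro has_derivative_eventuallyI)
  then show ?thesis by (rule differentiableI)
qed

text \<open>At contact the distance itself may have a kink, but it grows at most linearly there, so its square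
  is of second order.\<close>

lemma half_gap_squared_derivative_at_contact:
  assumes "gap pq0 = 0"
  shows "((\<lambda>pq. (gap pq)\<^sup>2 / 2) has_derivative (\<lambda>_. 0)) (at pq0)"
proof -
  obtain C where C: "0 < C" "\<forall>\<^sub>F pq in nhds pq0. gap pq \<le> C * norm (pq - pq0)"
    using gap_small_near_contact[OF assms] by blast
  have "\<forall>\<^sub>F pq in nhds pq0. norm ((gap pq)\<^sup>2 / 2 - (gap pq0)\<^sup>2 / 2 - 0) \<le> e * norm (pq - pq0)"
    if e: "0 < e" for e
  proof -
    have "\<forall>\<^sub>F pq in nhds pq0. norm (pq - pq0) < 2 * e / C\<^sup>2"
      using e C(1) by (intro eventually_norm_diff_less) simp
    with C(2) show ?thesis
    proof eventually_elim
      case (elim pq)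
      have "(gap pq)\<^sup>2 \<le> (C * norm (pq - pq0))\<^sup>2"
        using elim(1) by (intro power_mono) (auto simp: gap_def setdist_pos_le)
      also have "\<dots> = (C\<^sup>2 * norm (pq - pq0)) * norm (pq - pq0)"
        by (simp add: power2_eq_square algebra_simps)
      also have "\<dots> \<le> (2 * e) * norm (pq - pq0)"
        using elim(2) C(1) by (intro mult_right_mono) (auto simp: field_simps)
      finally show ?case using assms by simp
    qed
  qed
  then show ?thesis by (intro has_derivative_eventuallyI bounded_linear_zero)
qed

lemma half_gap_squared_differentiable: "(\<lambda>pq. (gap pq)\<^sup>2 / 2) differentiable (at pq0)"
proof (cases "gap pq0 = 0")
  case True
  then show ?thesis using half_gap_squared_derivative_at_contact differentiableI by blast
next
  case False
  then have "0 < gap pq0" using setdist_pos_le by (simp add: gap_def less_le)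
  then have "gap differentiable (at pq0)" by (rule gap_differentiable)
  then show ?thesis by (intro differentiable_divide differentiable_power) auto
qed

text \<open>Both infima are attained by compactness, so squaring commutes with the infimum.\<close>

lemma Inf_half_squared_distance:
  "Inf {(1/2) * (norm (x - y))\<^sup>2 | x y. x \<in> A.body p \<and> y \<in> B.body q} = (gap (p, q))\<^sup>2 / 2"
proof (rule cInf_eq_minimum)
  obtain x y where "x \<in> A.body p" "y \<in> B.body q" "dist x y = gap (p, q)"
    using gap_attained[of "(p, q)"] by auto
  then show "(gap (p, q))\<^sup>2 / 2 \<in> {(1/2) * (norm (x - y))\<^sup>2 | x y. x \<in> A.body p \<and> y \<in> B.body q}"
    by (force simp: dist_norm)
next
  fix z assume "z \<in> {(1/2) * (norm (x - y))\<^sup>2 | x y. x \<in> A.body p \<and> y \<in> B.body q}"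
  then obtain x y where z: "z = (1/2) * (norm (x - y))\<^sup>2" and "x \<in> A.body p" "y \<in> B.body q" by blast
  then have "gap (p, q) \<le> norm (x - y)"
    using setdist_le_dist by (fastforce simp: gap_def dist_norm)
  then have "(gap (p, q))\<^sup>2 \<le> (norm (x - y))\<^sup>2"
    by (intro power_mono) (auto simp: gap_def setdist_pos_le)
  then show "(gap (p, q))\<^sup>2 / 2 \<le> z" using z by simp
qed

end

section \<open>Sums of exponentials of convex constraints\<close>

text \<open>The one-dimensional tangent inequality on the line through \<open>x\<close> in direction \<open>v\<close>.\<close>

lemma convex_above_derivative:
  fixes f :: "'a::real_normed_vector \<Rightarrow> real"
  assumes "convex_on UNIV f" "(f has_derivative f') (at x)"
  shows "f x + f' v \<le> f (x + v)"
proof -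
  define \<phi> where "\<phi> t = f (x + t *\<^sub>R v)" for t
  have "convex_on UNIV \<phi>"
  proof (rule convex_onI)
    fix t y z :: real assume "0 < t" "t < 1"
    moreover have "x + ((1 - t) *\<^sub>R y + t *\<^sub>R z) *\<^sub>R v
        = (1 - t) *\<^sub>R (x + y *\<^sub>R v) + t *\<^sub>R (x + z *\<^sub>R v)"
      by (simp add: algebra_simps)
    ultimately show "\<phi> ((1 - t) *\<^sub>R y + t *\<^sub>R z) \<le> (1 - t) * \<phi> y + t * \<phi> z"
      unfolding \<phi>_def using convex_onD[OF assms(1)] by simp
  qed simp
  moreover have "(\<phi> has_field_derivative f' v) (at 0)"
  proof -
    have f: "(f has_derivative f') (at (x + 0 *\<^sub>R v))" using assms(2) by simp
    have "((\<lambda>t. x + t *\<^sub>R v) has_derivative (\<lambda>t. t *\<^sub>R v)) (at (0::real))"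
      by (auto intro!: derivative_eq_intros)
    from has_derivative_compose[OF this f]
    have "(\<phi> has_derivative (\<lambda>t. f' (t *\<^sub>R v))) (at 0)" by (simp add: \<phi>_def[abs_def])
    then show ?thesis
      using linear_cmul[OF has_derivative_linear[OF assms(2)]]
      by (simp add: has_field_derivative_def mult_commute_abs)
  qed
  ultimately have "\<phi> 1 - \<phi> 0 \<ge> f' v * (1 - 0)"
    by (intro convex_on_imp_above_tangent[of UNIV]) auto
  then show ?thesis by (simp add: \<phi>_def)
qed

text \<open>The minimum of the quadratic form on the unit sphere is attained, and it is not \<open>0\<close> because no nonzero
  vector is orthogonal to a spanning family.\<close>

lemma spanning_family_positive_definite:
  fixes b :: "'k \<Rightarrow> 'a::euclidean_space"
  assumes "span (b ` I) = UNIV" "finite I"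
  obtains \<mu> where "0 < \<mu>" "\<And>v. \<mu> * (norm v)\<^sup>2 \<le> (\<Sum>k\<in>I. (b k \<bullet> v)\<^sup>2)"
proof -
  define Q where "Q v = (\<Sum>k\<in>I. (b k \<bullet> v)\<^sup>2)" for v
  have "continuous_on (sphere 0 1) Q" unfolding Q_def by (intro continuous_intros)
  moreover have "sphere (0::'a) 1 \<noteq> {}"
    using vector_choose_size[of 1, where ?'a = 'a] by auto
  ultimately obtain u where u: "norm u = 1" "\<And>v. norm v = 1 \<Longrightarrow> Q u \<le> Q v"
    using continuous_attains_inf[OF compact_sphere] by (metis dist_0_norm mem_sphere)
  have "Q u \<noteq> 0"
  proof
    assume "Q u = 0"
    then have "\<forall>k\<in>I. b k \<bullet> u = 0" using assms(2) by (simp add: Q_def sum_nonneg_eq_0_iff)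
    then have "orthogonal u y" if "y \<in> b ` I" for y
      using that by (auto simp: orthogonal_def inner_commute)
    then have "orthogonal u u" using orthogonal_to_span[of u "b ` I" u] assms(1) by simp
    then show False using u(1) by (auto simp: orthogonal_def)
  qed
  moreover have "0 \<le> Q u" unfolding Q_def by (intro sum_nonneg) simp
  moreover have "Q u * (norm v)\<^sup>2 \<le> Q v" for v
  proof (cases "v = 0")
    case True then show ?thesis by (simp add: Q_def)
  next
    case False
    have "Q v = (norm v)\<^sup>2 * Q ((1 / norm v) *\<^sub>R v)"
      using False by (simp add: Q_def sum_distrib_left power_divide)
    moreover have "Q u \<le> Q ((1 / norm v) *\<^sub>R v)" using False by (intro u(2)) simp
    ultimately show ?thesis by (metis mult.commute mult_left_mono zero_le_power2)
  qed
  ultimately show thesis using that[of "Q u"] by (simp add: Q_def less_le)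
qed

text \<open>The square of the tangent bound \<open>1 + s / 2 \<le> exp (s / 2)\<close>.\<close>

lemma exp_quadratic_lower:
  fixes s :: real assumes "\<bar>s\<bar> \<le> 1"
  shows "1 + s + s\<^sup>2 / 4 \<le> exp s"
proof -
  have "(1 + s / 2)\<^sup>2 \<le> (exp (s / 2))\<^sup>2"
    using assms by (intro power_mono) auto
  moreover have "(exp (s / 2))\<^sup>2 = exp s" by (simp add: power2_eq_square flip: exp_add)
  ultimately show ?thesis by (simp add: power2_eq_square algebra_simps)
qed

lemma grad_x_has_derivative:
  assumes "(\<lambda>y. F k y l) differentiable (at x)"
  shows "((\<lambda>y. F k y l) has_derivative (\<lambda>v. grad_x F k x l \<bullet> v)) (at x)"
proof -
  let ?D = "frechet_derivative (\<lambda>y. F k y l) (at x)"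
  have D: "((\<lambda>y. F k y l) has_derivative ?D) (at x)"
    using assms by (simp add: frechet_derivative_works)
  then interpret linear ?D by (rule has_derivative_linear)
  have "?D v = grad_x F k x l \<bullet> v" for v
  proof -
    have "?D v = ?D (\<Sum>i\<in>UNIV. v $ i *\<^sub>R axis i 1)"
      by (simp add: basis_expansion flip: scalar_mult_eq_scaleR)
    also have "\<dots> = grad_x F k x l \<bullet> v"
      by (simp add: sum scale grad_x_def inner_vec_def mult.commute)
    finally show ?thesis .
  qed
  then have "?D = (\<lambda>v. grad_x F k x l \<bullet> v)" by blast
  then show ?thesis using D by simp
qed

text \<open>A defining function of the overapproximation without the logarithm. It is convex because \<open>exp\<close> is
  convex and increasing, and its curvature in direction \<open>v\<close> contains the squares of
  \<open>grad_x F k x l \<bullet> v\<close> even where the constraints themselves are affine.\<close>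

definition exp_sum_excess ::
  "real \<Rightarrow> nat \<Rightarrow> (nat \<Rightarrow> real^'n \<Rightarrow> 'l \<Rightarrow> real) \<Rightarrow> real^'n \<Rightarrow> 'l \<Rightarrow> real" where
  "exp_sum_excess eps n F x l = (\<Sum>k=1..n. exp (eps * F k x l)) - real n"

lemma overapprox_eq_sublevel:
  assumes "0 < eps"
  shows "overapprox eps n F l = {x. exp_sum_excess eps n F x l \<le> 0}"
proof -
  have "0 < 1 + (\<Sum>k=1..n. exp (eps * F k x l))" for x
    by (intro add_pos_nonneg sum_nonneg) auto
  then show ?thesis
    using assms by (auto simp: overapprox_def LSEp_def exp_sum_excess_def divide_le_cancel)
qed

text \<open>The consequences of the standard conditions and of the rank condition that make the
  overapproximation a moving convex body.\<close>

locale regular_constraints =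
  fixes eps :: real and n :: nat and F :: "nat \<Rightarrow> real^'n \<Rightarrow> 'l::euclidean_space \<Rightarrow> real"
  assumes eps: "0 < eps"
    and convex: "k \<in> {1..n} \<Longrightarrow> convex_on UNIV (\<lambda>x. F k x l)"
    and derivative: "k \<in> {1..n} \<Longrightarrow>
          ((\<lambda>y. F k y l) has_derivative (\<lambda>v. grad_x F k x l \<bullet> v)) (at x)"
    and parameter: "k \<in> {1..n} \<Longrightarrow> F k x differentiable (at l)"
    and grad_parameter: "k \<in> {1..n} \<Longrightarrow> grad_x F k x differentiable (at l)"
    and spanning: "span ((\<lambda>k. grad_x F k x l) ` {1..n}) = UNIV"
    and bounded_feasible: "bounded {x. \<forall>k\<in>{1..n}. F k x l \<le> 0}"
    and interior_feasible: "interior {x. \<forall>k\<in>{1..n}. F k x l \<le> 0} \<noteq> {}"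
begin

abbreviation G where "G \<equiv> exp_sum_excess eps n F"

definition gradG :: "real^'n \<Rightarrow> 'l \<Rightarrow> real^'n" where
  "gradG x l = (\<Sum>k=1..n. exp (eps * F k x l) *\<^sub>R (eps *\<^sub>R grad_x F k x l))"

lemma exp_differentiable: "k \<in> {1..n} \<Longrightarrow> (\<lambda>l. exp (c * F k x l)) differentiable (at l)"
proof -
  assume "k \<in> {1..n}"
  then obtain f' where "(F k x has_derivative f') (at l)"
    using parameter unfolding differentiable_def by blast
  then have "((\<lambda>l. exp (c * F k x l)) has_derivative (\<lambda>v. exp (c * F k x l) * (c * f' v))) (at l)"
    by (auto intro!: derivative_eq_intros)
  then show ?thesis by (rule differentiableI)
qed

lemma gradG_derivative: "((\<lambda>x. G x l) has_derivative (\<lambda>v. gradG x l \<bullet> v)) (at x)"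
proof -
  have "((\<lambda>x. exp (eps * F k x l)) has_derivative
      (\<lambda>v. (exp (eps * F k x l) *\<^sub>R (eps *\<^sub>R grad_x F k x l)) \<bullet> v)) (at x)" if "k \<in> {1..n}" for k
    using derivative[OF that] by (auto intro!: derivative_eq_intros)
  then have "((\<lambda>x. (\<Sum>k=1..n. exp (eps * F k x l)) - real n) has_derivative
      (\<lambda>v. (\<Sum>k=1..n. (exp (eps * F k x l) *\<^sub>R (eps *\<^sub>R grad_x F k x l)) \<bullet> v) - 0)) (at x)"
    by (intro has_derivative_diff has_derivative_sum has_derivative_const) auto
  then show ?thesis by (simp add: exp_sum_excess_def gradG_def inner_sum_left)
qed

lemma gradG_differentiable: "gradG x differentiable (at l)"
  unfolding gradG_def
  by (intro differentiable_sum differentiable_scaleR differentiable_const ballI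
      exp_differentiable grad_parameter finite_atLeastAtMost)

text \<open>Every summand lies above the exponential of the tangent of its constraint, which
  exceeds its own tangent by a multiple of the square of \<open>b l k \<bullet> v\<close>. The vectors
  \<open>b l k\<close>, the gradients scaled by the square roots of the weights \<open>exp (eps * F k x l)\<close>, span the space
  and are continuous in \<open>l\<close> at the fixed point \<open>x\<close>, so the resulting
  quadratic form has a positive lower bound uniform in \<open>l\<close> near \<open>l0\<close>.\<close>

lemma G_growth:
  obtains m r where "0 < m" "0 < r"
    "\<forall>\<^sub>F l in nhds l0. \<forall>v. norm v \<le> r \<longrightarrow>
        G x l + gradG x l \<bullet> v + m * (norm v)\<^sup>2 \<le> G (x + v) l"
proof -
  define b where "b l k = exp (eps / 2 * F k x l) *\<^sub>R grad_x F k x l" for l k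
  have span_b: "span (b l0 ` {1..n}) = UNIV"
  proof -
    have "grad_x F k x l0 \<in> span (b l0 ` {1..n})" if "k \<in> {1..n}" for k
    proof -
      have "grad_x F k x l0 = exp (- (eps / 2 * F k x l0)) *\<^sub>R b l0 k"
        by (simp add: b_def flip: exp_add)
      then show ?thesis using that by (metis imageI span_base span_scale)
    qed
    then have "span ((\<lambda>k. grad_x F k x l0) ` {1..n}) \<subseteq> span (b l0 ` {1..n})"
      by (intro span_minimal) auto
    then show ?thesis using spanning by auto
  qed
  obtain \<mu> where \<mu>: "0 < \<mu>" "\<And>v. \<mu> * (norm v)\<^sup>2 \<le> (\<Sum>k=1..n. (b l0 k \<bullet> v)\<^sup>2)"
    using spanning_family_positive_definite[OF span_b] by auto
  have cont: "(f \<longlongrightarrow> f l0) (nhds l0)" if "f differentiable (at l0)"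
    for f :: "'l \<Rightarrow> real^'n"
    using differentiable_imp_continuous_within[OF that]
    by (simp add: continuous_within tendsto_at_iff_tendsto_nhds)
  have "((\<lambda>l. b l k) \<longlongrightarrow> b l0 k) (nhds l0)" if "k \<in> {1..n}" for k
    unfolding b_def by (rule cont) (intro differentiable_scaleR exp_differentiable grad_parameter that)
  then have "((\<lambda>l. \<Sum>k=1..n. (norm (b l k - b l0 k))\<^sup>2) \<longlongrightarrow> (\<Sum>k=1..n. (norm (b l0 k - b l0 k))\<^sup>2)) (nhds l0)"
    by (intro tendsto_sum tendsto_power tendsto_norm tendsto_diff tendsto_const) auto
  then have close: "\<forall>\<^sub>F l in nhds l0. (\<Sum>k=1..n. (norm (b l k - b l0 k))\<^sup>2) < \<mu> / 4"
    using \<mu>(1) by (intro order_tendstoD(2)) auto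
  \<comment> \<open>A bound on the gradients near \<open>l0\<close>; the radius \<open>1 / (eps * M)\<close> keeps every exponent change in \<open>{-1..1}\<close>.\<close>
  define M where "M = 1 + (\<Sum>k=1..n. norm (grad_x F k x l0))"
  have M: "0 < M" unfolding M_def by (intro add_pos_nonneg sum_nonneg) auto
  have "\<forall>\<^sub>F l in nhds l0. norm (grad_x F k x l) < M" if "k \<in> {1..n}" for k
  proof (rule order_tendstoD(2))
    show "((\<lambda>l. norm (grad_x F k x l)) \<longlongrightarrow> norm (grad_x F k x l0)) (nhds l0)"
      using cont[OF grad_parameter[OF that]] by (rule tendsto_norm)
    show "norm (grad_x F k x l0) < M"
      using member_le_sum[OF that, of "\<lambda>k. norm (grad_x F k x l0)"] by (simp add: M_def)
  qed
  then have bound: "\<forall>\<^sub>F l in nhds l0. \<forall>k\<in>{1..n}. norm (grad_x F k x l) < M"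
    by (intro eventually_ball_finite) auto
  have "\<forall>\<^sub>F l in nhds l0. \<forall>v. norm v \<le> 1 / (eps * M) \<longrightarrow>
        G x l + gradG x l \<bullet> v + (eps\<^sup>2 * \<mu> / 16) * (norm v)\<^sup>2 \<le> G (x + v) l"
    using close bound
  proof eventually_elim
    case (elim l)
    show ?case
    proof (intro allI impI)
      fix v :: "real^'n" assume v: "norm v \<le> 1 / (eps * M)"
      have summand: "exp (eps * F k x l) + (exp (eps * F k x l) *\<^sub>R (eps *\<^sub>R grad_x F k x l)) \<bullet> v
          + eps\<^sup>2 / 4 * (b l k \<bullet> v)\<^sup>2 \<le> exp (eps * F k (x + v) l)" if k: "k \<in> {1..n}" for k
      proof -
        define s where "s = eps * (grad_x F k x l \<bullet> v)"
        have "\<bar>grad_x F k x l \<bullet> v\<bar> \<le> norm (grad_x F k x l) * norm v" by (rule Cauchy_Schwarz_ineq2)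
        also have "\<dots> \<le> M * (1 / (eps * M))" using elim(2) k v M
          by (intro mult_mono) (auto intro: less_imp_le)
        also have "\<dots> = 1 / eps" using M by simp
        finally have s: "\<bar>s\<bar> \<le> 1" using eps by (simp add: s_def abs_mult field_simps)
        have sq: "(b l k \<bullet> v)\<^sup>2 = exp (eps * F k x l) * (grad_x F k x l \<bullet> v)\<^sup>2"
          by (simp add: b_def power_mult_distrib power2_eq_square flip: exp_add)
        have "F k x l + grad_x F k x l \<bullet> v \<le> F k (x + v) l"
          by (rule convex_above_derivative[OF convex[OF k] derivative[OF k]])
        then have "eps * F k x l + s \<le> eps * F k (x + v) l"
          using eps by (simp add: s_def flip: distrib_left)
        then have "exp (eps * F k x l) * exp s \<le> exp (eps * F k (x + v) l)" by (simp flip: exp_add)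
        moreover have "exp (eps * F k x l) * (1 + s + s\<^sup>2 / 4) \<le> exp (eps * F k x l) * exp s"
          using exp_quadratic_lower[OF s] by simp
        ultimately show ?thesis
          by (simp add: sq s_def algebra_simps power_mult_distrib)
      qed
      have "\<mu> / 4 * (norm v)\<^sup>2 \<le> (\<Sum>k=1..n. (b l k \<bullet> v)\<^sup>2)"
      proof -
        \<comment> \<open>Half the form at \<open>l0\<close>, minus the distance of the two families, bounds the form at \<open>l\<close> from below.\<close>
        have "(b l0 k \<bullet> v)\<^sup>2 \<le> 2 * (b l k \<bullet> v)\<^sup>2 + 2 * ((norm (b l k - b l0 k))\<^sup>2 * (norm v)\<^sup>2)" for k
        proof -
          define p where "p = b l k \<bullet> v"
          define d where "d = (b l k - b l0 k) \<bullet> v"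
          have "\<bar>d\<bar> \<le> norm (b l k - b l0 k) * norm v" unfolding d_def by (rule Cauchy_Schwarz_ineq2)
          then have "\<bar>d\<bar>\<^sup>2 \<le> (norm (b l k - b l0 k) * norm v)\<^sup>2" by (rule power_mono) simp
          then have 1: "d\<^sup>2 \<le> (norm (b l k - b l0 k))\<^sup>2 * (norm v)\<^sup>2" by (simp add: power_mult_distrib)
          have "0 \<le> (p + d)\<^sup>2" by simp
          then have "(p - d)\<^sup>2 \<le> 2 * p\<^sup>2 + 2 * d\<^sup>2" by (simp add: power2_eq_square algebra_simps)
          moreover have "b l0 k \<bullet> v = p - d" by (simp add: p_def d_def inner_diff_left)
          ultimately show ?thesis using 1 by (simp add: p_def)
        qed
        then have "(\<Sum>k=1..n. (b l0 k \<bullet> v)\<^sup>2) \<le> (\<Sum>k=1..n. 2 * (b l k \<bullet> v)\<^sup>2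
            + 2 * ((norm (b l k - b l0 k))\<^sup>2 * (norm v)\<^sup>2))"
          by (rule sum_mono)
        also have "\<dots> = 2 * (\<Sum>k=1..n. (b l k \<bullet> v)\<^sup>2)
            + 2 * ((\<Sum>k=1..n. (norm (b l k - b l0 k))\<^sup>2) * (norm v)\<^sup>2)"
          by (simp add: sum.distrib sum_distrib_left sum_distrib_right)
        also have "\<dots> \<le> 2 * (\<Sum>k=1..n. (b l k \<bullet> v)\<^sup>2) + 2 * (\<mu> / 4 * (norm v)\<^sup>2)"
          using elim(1) by (intro add_left_mono mult_left_mono mult_right_mono) auto
        finally show ?thesis using \<mu>(2)[of v] by simp
      qed
      then have "eps\<^sup>2 / 4 * (\<mu> / 4 * (norm v)\<^sup>2) \<le> eps\<^sup>2 / 4 * (\<Sum>k=1..n. (b l k \<bullet> v)\<^sup>2)"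
        by (intro mult_left_mono) auto
      moreover have "(\<Sum>k=1..n. exp (eps * F k x l) + (exp (eps * F k x l) *\<^sub>R (eps *\<^sub>R grad_x F k x l)) \<bullet> v
          + eps\<^sup>2 / 4 * (b l k \<bullet> v)\<^sup>2) \<le> (\<Sum>k=1..n. exp (eps * F k (x + v) l))"
        by (rule sum_mono) (rule summand)
      moreover have "(\<Sum>k=1..n. exp (eps * F k x l) + (exp (eps * F k x l) *\<^sub>R (eps *\<^sub>R grad_x F k x l)) \<bullet> v
          + eps\<^sup>2 / 4 * (b l k \<bullet> v)\<^sup>2)
          = (\<Sum>k=1..n. exp (eps * F k x l)) + gradG x l \<bullet> v + eps\<^sup>2 / 4 * (\<Sum>k=1..n. (b l k \<bullet> v)\<^sup>2)"
        by (simp only: sum.distrib gradG_def inner_sum_left sum_distrib_left)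
      moreover have "eps\<^sup>2 / 4 * (\<mu> / 4 * (norm v)\<^sup>2) = (eps\<^sup>2 * \<mu> / 16) * (norm v)\<^sup>2" by simp
      ultimately show "G x l + gradG x l \<bullet> v + (eps\<^sup>2 * \<mu> / 16) * (norm v)\<^sup>2 \<le> G (x + v) l"
        unfolding exp_sum_excess_def by linarith
    qed
  qed
  then show thesis using that[of "eps\<^sup>2 * \<mu> / 16" "1 / (eps * M)"] eps \<mu>(1) M by simp
qed

lemma G_nonpos_if_feasible: "\<forall>k\<in>{1..n}. F k x l \<le> 0 \<Longrightarrow> G x l \<le> 0"
  using overapprox_superset[OF eps, of n F l] by (auto simp: overapprox_eq_sublevel[OF eps])

text \<open>\<open>G\<close> is nonpositive near an interior point of the feasible set and grows quadratically around it,
  so averaging over \<open>x + v\<close> and \<open>x - v\<close> makes it negative at the centre.\<close>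

lemma G_strictly_feasible: "\<exists>x. G x l < 0"
proof -
  obtain x where "x \<in> interior {x. \<forall>k\<in>{1..n}. F k x l \<le> 0}" using interior_feasible by blast
  then obtain \<rho> where \<rho>: "0 < \<rho>" "ball x \<rho> \<subseteq> {x. \<forall>k\<in>{1..n}. F k x l \<le> 0}"
    by (auto simp: mem_interior)
  have neg: "G y l \<le> 0" if "dist x y < \<rho>" for y
    using \<rho>(2) that by (intro G_nonpos_if_feasible) (auto simp: subset_iff)
  obtain m r where mr: "0 < m" "0 < r"
    and ev: "\<forall>\<^sub>F l' in nhds l. \<forall>v. norm v \<le> r \<longrightarrow>
        G x l' + gradG x l' \<bullet> v + m * (norm v)\<^sup>2 \<le> G (x + v) l'"
    using G_growth by blast
  obtain e :: "real^'n" where e: "norm e = 1" using vector_choose_size[of 1] by auto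
  define v where "v = min r (\<rho> / 2) *\<^sub>R e"
  have v: "norm v = min r (\<rho> / 2)" using e mr \<rho> by (simp add: v_def)
  have "norm v \<le> r" using v by simp
  then have "G x l + gradG x l \<bullet> v + m * (norm v)\<^sup>2 \<le> G (x + v) l"
    and "G x l + gradG x l \<bullet> (- v) + m * (norm v)\<^sup>2 \<le> G (x - v) l"
    using eventually_nhds_x_imp_x[OF ev, rule_format, of v]
      eventually_nhds_x_imp_x[OF ev, rule_format, of "- v"] by simp_all
  moreover have "G (x + v) l \<le> 0" "G (x - v) l \<le> 0"
    using v \<rho>(1) by (auto intro!: neg simp: dist_norm)
  moreover have "0 < m * (norm v)\<^sup>2" using v mr \<rho> by (intro mult_pos_pos) auto
  ultimately have "G x l < 0" by simp
  then show ?thesis by blast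
qed

text \<open>The total violation \<open>H\<close> vanishes at a feasible point \<open>xb\<close> and has a positive minimum on a sphere
  around the feasible set. By convexity it grows at least linearly outside the sphere, while on the
  sublevel set of \<open>G\<close> each constraint is at most \<open>ln n / eps\<close>.\<close>

lemma G_bounded_sublevel: "bounded {x. G x l \<le> 0}"
proof -
  let ?S = "{x. \<forall>k\<in>{1..n}. F k x l \<le> 0}"
  obtain xb where xb: "xb \<in> ?S" using interior_feasible interior_subset by blast
  obtain r where r: "0 < r" "?S \<subseteq> ball xb r" using bounded_subset_ballD[OF bounded_feasible] by blast
  define H where "H x = (\<Sum>k=1..n. max 0 (F k x l))" for x
  have "continuous_on UNIV (\<lambda>x. F k x l)" if "k \<in> {1..n}" for k
    by (rule convex_on_continuous[OF open_UNIV convex[OF that]])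
  then have cont: "continuous_on (sphere xb r) H"
    unfolding H_def by (intro continuous_on_sum continuous_on_max continuous_on_const)
      (auto intro: continuous_on_subset)
  have "sphere xb r \<noteq> {}" using r(1) by simp
  then obtain z where z: "z \<in> sphere xb r" "\<And>y. y \<in> sphere xb r \<Longrightarrow> H z \<le> H y"
    using continuous_attains_inf[OF compact_sphere _ cont] by blast
  have "0 < H z"
  proof -
    have "z \<notin> ?S" using z(1) r(2) by (auto simp: subset_iff)
    then obtain k where k: "k \<in> {1..n}" "0 < F k z l" by force
    then show ?thesis unfolding H_def by (intro sum_pos2[of _ k]) auto
  qed
  define q where "q = real n * (ln (real n) / eps)"
  have "norm (x - xb) \<le> max r (r * q / H z)" if x: "G x l \<le> 0" for x
  proof (cases "norm (x - xb) \<le> r")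
    case False
    define t where "t = r / norm (x - xb)"
    have "0 < norm (x - xb)" using False r(1) by linarith
    then have t: "0 < t" "t \<le> 1" "t * norm (x - xb) = r" using False r(1) by (auto simp: t_def)
    have Fx: "F k x l \<le> ln (real n) / eps" if k: "k \<in> {1..n}" for k
    proof -
      have "exp (eps * F k x l) \<le> (\<Sum>k=1..n. exp (eps * F k x l))"
        using k by (intro member_le_sum) auto
      also have "\<dots> \<le> real n" using x by (simp add: exp_sum_excess_def)
      finally have "eps * F k x l \<le> ln (real n)" using k by (simp add: ln_ge_iff)
      then show ?thesis using eps by (simp add: field_simps)
    qed
    have "H x \<le> (\<Sum>k=1..n. ln (real n) / eps)"
      unfolding H_def using Fx eps by (intro sum_mono) (auto intro!: divide_nonneg_pos)
    then have Hx: "H x \<le> q" by (simp add: q_def)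
    have "max 0 (F k (xb + t *\<^sub>R (x - xb)) l) \<le> t * max 0 (F k x l)" if k: "k \<in> {1..n}" for k
    proof -
      have "F k ((1 - t) *\<^sub>R xb + t *\<^sub>R x) l \<le> (1 - t) * F k xb l + t * F k x l"
        using convex_onD[OF convex[OF k]] t by simp
      also have "\<dots> \<le> (1 - t) * 0 + t * max 0 (F k x l)"
        using xb k t by (intro add_mono mult_left_mono) auto
      finally show ?thesis using t by (simp add: algebra_simps)
    qed
    then have "H (xb + t *\<^sub>R (x - xb)) \<le> t * H x"
      unfolding H_def sum_distrib_left by (rule sum_mono)
    moreover have "xb + t *\<^sub>R (x - xb) \<in> sphere xb r" using t by (simp add: dist_norm)
    ultimately have "H z \<le> t * H x" using z(2) by (meson order_trans)
    also have "\<dots> \<le> t * q" using Hx t by simp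
    finally have "H z * norm (x - xb) \<le> (t * q) * norm (x - xb)" by (intro mult_right_mono) auto
    also have "\<dots> = r * q" using t(3) by (metis mult.assoc mult.commute)
    finally have "norm (x - xb) \<le> r * q / H z" using \<open>0 < H z\<close> by (simp add: field_simps)
    then show ?thesis by simp
  qed auto
  then have "{x. G x l \<le> 0} \<subseteq> cball xb (max r (r * q / H z))"
    by (auto simp: dist_norm norm_minus_commute)
  then show ?thesis by (rule bounded_subset[OF bounded_cball])
qed

sublocale moving_convex_body G
proof
  show "convex_on UNIV (\<lambda>x. G x l)" for l
  proof (rule convex_onI)
    fix t :: real and x y :: "real^'n"
    assume t: "0 < t" "t < 1"
    have "exp (eps * F k ((1 - t) *\<^sub>R x + t *\<^sub>R y) l)
        \<le> (1 - t) * exp (eps * F k x l) + t * exp (eps * F k y l)" if k: "k \<in> {1..n}" for k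
    proof -
      have "eps * F k ((1 - t) *\<^sub>R x + t *\<^sub>R y) l \<le> eps * ((1 - t) * F k x l + t * F k y l)"
        using convex_onD[OF convex[OF k]] t eps by simp
      then have "exp (eps * F k ((1 - t) *\<^sub>R x + t *\<^sub>R y) l)
          \<le> exp ((1 - t) *\<^sub>R (eps * F k x l) + t *\<^sub>R (eps * F k y l))"
        by (simp add: algebra_simps)
      also have "\<dots> \<le> (1 - t) * exp (eps * F k x l) + t * exp (eps * F k y l)"
        using convex_onD[OF exp_convex] t by simp
      finally show ?thesis .
    qed
    then have "(\<Sum>k=1..n. exp (eps * F k ((1 - t) *\<^sub>R x + t *\<^sub>R y) l))
        \<le> (\<Sum>k=1..n. (1 - t) * exp (eps * F k x l) + t * exp (eps * F k y l))"
      by (rule sum_mono)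
    also have "\<dots> = (1 - t) * (\<Sum>k=1..n. exp (eps * F k x l)) + t * (\<Sum>k=1..n. exp (eps * F k y l))"
      by (simp only: sum.distrib sum_distrib_left)
    finally show "G ((1 - t) *\<^sub>R x + t *\<^sub>R y) l \<le> (1 - t) * G x l + t * G y l"
      by (simp add: exp_sum_excess_def algebra_simps)
  qed simp
  show "G x differentiable (at l)" for x l
    unfolding exp_sum_excess_def
    by (intro differentiable_diff differentiable_sum differentiable_const ballI
        exp_differentiable finite_atLeastAtMost)
  show "\<exists>a m r. a differentiable (at l0) \<and> 0 < m \<and> 0 < r \<and>
          ((\<lambda>x. G x l0) has_derivative (\<lambda>v. a l0 \<bullet> v)) (at x0) \<and>
          (\<forall>\<^sub>F l in nhds l0. \<forall>v. norm v \<le> r \<longrightarrow> G x0 l + a l \<bullet> v + m * (norm v)\<^sup>2 \<le> G (x0 + v) l)"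
    for l0 x0
  proof -
    obtain m r where "0 < m" "0 < r" "\<forall>\<^sub>F l in nhds l0. \<forall>v. norm v \<le> r \<longrightarrow>
        G x0 l + gradG x0 l \<bullet> v + m * (norm v)\<^sup>2 \<le> G (x0 + v) l"
      using G_growth by blast
    then show ?thesis using gradG_differentiable gradG_derivative by blast
  qed
qed (rule G_bounded_sublevel, rule G_strictly_feasible)

lemma body_eq_overapprox: "body l = overapprox eps n F l"
  by (simp add: body_def overapprox_eq_sublevel[OF eps])

end

lemma regular_constraints_if_standard_conditions:
  assumes "0 < eps" and std: "standard_conditions S n F" and rank: "full_column_rank n F"
  shows "regular_constraints eps n F"
proof -
  have S: "compact (S l)" "interior (S l) \<noteq> {}" "S l = {x. \<forall>k\<in>{1..n}. F k x l \<le> 0}" for l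
    using std unfolding standard_conditions_def by auto
  have F: "convex_on UNIV (\<lambda>x. F k x l)" "(\<lambda>y. F k y l) differentiable (at x)"
      "Ck 1 (F k x)" "Ck 1 (grad_x F k x)" if "k \<in> {1..n}" for k x l
    using std that unfolding standard_conditions_def by auto
  show ?thesis
  proof
    show "span ((\<lambda>k. grad_x F k x l) ` {1..n}) = UNIV" for x l
      using rank unfolding full_column_rank_def by (simp flip: dim_eq_full)
    show "bounded {x. \<forall>k\<in>{1..n}. F k x l \<le> 0}" for l
      using compact_imp_bounded[OF S(1)[of l]] S(3)[of l] by simp
    show "interior {x. \<forall>k\<in>{1..n}. F k x l \<le> 0} \<noteq> {}" for l using S(2,3)[of l] by simp
  qed (use F assms(1) in \<open>auto intro: grad_x_has_derivative\<close>)
qed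

section \<open>Barrier functions along a trajectory\<close>

lemma partial_derivative_in_first:
  assumes "((\<lambda>pq. \<phi> (fst pq) (snd pq)) has_derivative D) (at (p, q))"
  shows "((\<lambda>p. \<phi> p q) has_derivative (\<lambda>v. D (v, 0))) (at p)"
proof -
  have "((\<lambda>p. (p, q)) has_derivative (\<lambda>v. (v, 0))) (at p)"
    by (auto intro!: derivative_eq_intros)
  from has_derivative_compose[OF this assms] show ?thesis by simp
qed

lemma partial_derivative_in_second:
  assumes "((\<lambda>pq. \<phi> (fst pq) (snd pq)) has_derivative D) (at (p, q))"
  shows "((\<lambda>q. \<phi> p q) has_derivative (\<lambda>v. D (0, v))) (at q)"
proof -
  have "((\<lambda>q. (p, q)) has_derivative (\<lambda>v. (0, v))) (at q)"
    by (auto intro!: derivative_eq_intros)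
  from has_derivative_compose[OF this assms] show ?thesis by simp
qed

text \<open>Moving from \<open>x\<close> along \<open>v\<close> or along \<open>P v\<close> gives the same values of \<open>\<phi>\<close>. With \<open>P = block own j\<close> this
  identifies the derivative in \<open>\<lambda>\<^sub>j\<close> with the derivative in the whole parameter vector.\<close>

lemma derivative_factors_through_projection:
  fixes \<phi> :: "'a::real_normed_vector \<Rightarrow> 'b::real_normed_vector"
  assumes D: "(\<phi> has_derivative D) (at x)"
    and P: "linear P" "P (P v) = P v" "\<And>y. \<phi> (P y) = \<phi> y"
  shows "D (P v) = D v"
proof -
  interpret P: linear P by (rule P(1))
  have line: "((\<lambda>t. \<phi> (x + t *\<^sub>R w)) has_derivative (\<lambda>t. D (t *\<^sub>R w))) (at (0::real))" for w
  proof -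
    have "((\<lambda>t. x + t *\<^sub>R w) has_derivative (\<lambda>t. t *\<^sub>R w)) (at (0::real))"
      by (auto intro!: derivative_eq_intros)
    moreover have "(\<phi> has_derivative D) (at (x + 0 *\<^sub>R w))" using D by simp
    ultimately show ?thesis by (rule has_derivative_compose)
  qed
  have "\<phi> (x + t *\<^sub>R P v) = \<phi> (x + t *\<^sub>R v)" for t
    using P(3)[of "x + t *\<^sub>R P v"] P(3)[of "x + t *\<^sub>R v"] P(2) by (simp add: P.add P.scale)
  then have "(\<lambda>t. D (t *\<^sub>R P v)) = (\<lambda>t. D (t *\<^sub>R v))"
    using has_derivative_unique[OF line[of "P v"]] line[of v] by simp
  from fun_cong[OF this, of 1] show ?thesis by simp
qed

lemma linear_block: "linear (block own j)"
  by (rule linearI) (auto simp: block_def vec_eq_iff)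

lemma block_idem: "block own j (block own j l) = block own j l"
  by (simp add: block_def vec_eq_iff)

text \<open>Where \<open>\<phi>\<close> is negative the differential inequality makes it nondecreasing. If \<open>\<phi> t\<^sub>1\<close> is negative, so is
  \<open>\<phi>\<close> shortly before, and \<open>\<phi> t\<^sub>1\<close> is at least a value that exceeds \<open>c\<close>.\<close>

lemma class_K_barrier_positive_at_end:
  fixes \<phi> \<alpha> :: "real \<Rightarrow> real"
  assumes K: "extended_class_K \<alpha>" and c: "c < 0" and t: "t\<^sub>0 < t\<^sub>1"
    and cont: "continuous_on {t\<^sub>0..t\<^sub>1} \<phi>"
    and above: "\<And>t. t \<in> {t\<^sub>0..<t\<^sub>1} \<Longrightarrow> c < \<phi> t"
    and deriv: "\<And>t. t \<in> {t\<^sub>0..<t\<^sub>1} \<Longrightarrow>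
      \<exists>d. (\<phi> has_vector_derivative d) (at t within {t\<^sub>0..t\<^sub>1}) \<and> - \<alpha> (\<phi> t) \<le> d"
  shows "c < \<phi> t\<^sub>1"
proof (cases "\<phi> t\<^sub>1 < 0")
  case True
  have "(\<phi> \<longlongrightarrow> \<phi> t\<^sub>1) (at t\<^sub>1 within {t\<^sub>0..t\<^sub>1})"
    using cont t by (simp add: continuous_on_def)
  then have "\<forall>\<^sub>F t in at t\<^sub>1 within {t\<^sub>0..t\<^sub>1}. \<phi> t < 0" using True by (rule order_tendstoD)
  then obtain d where d: "0 < d" "\<And>t. t \<in> {t\<^sub>0..t\<^sub>1} \<Longrightarrow> t \<noteq> t\<^sub>1 \<Longrightarrow> dist t t\<^sub>1 < d \<Longrightarrow> \<phi> t < 0"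
    unfolding eventually_at by blast
  define s where "s = max t\<^sub>0 (t\<^sub>1 - d / 2)"
  have s: "t\<^sub>0 \<le> s" "s < t\<^sub>1" "t\<^sub>1 - s < d" using t d(1) by (auto simp: s_def)
  have "\<phi> s \<le> \<phi> t\<^sub>1"
  proof (rule DERIV_nonneg_imp_increasing_open[where f = \<phi>])
    show "s \<le> t\<^sub>1" using s by simp
    show "continuous_on {s..t\<^sub>1} \<phi>" using cont s by (auto intro: continuous_on_subset)
    fix x assume x: "s < x" "x < t\<^sub>1"
    then have neg: "\<phi> x < 0" using s by (intro d(2)) (auto simp: dist_real_def)
    obtain y where y: "(\<phi> has_vector_derivative y) (at x within {t\<^sub>0..t\<^sub>1})" "- \<alpha> (\<phi> x) \<le> y"
      using deriv[of x] x s by auto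
    have "\<alpha> (\<phi> x) < \<alpha> 0" using neg K unfolding extended_class_K_def by (blast intro: strict_monoD)
    then have "0 \<le> y" using y(2) K by (simp add: extended_class_K_def)
    moreover have "(\<phi> has_field_derivative y) (at x)"
      using y(1) x s by (simp add: has_real_derivative_iff_has_vector_derivative at_within_Icc_at)
    ultimately show "\<exists>y. (\<phi> has_field_derivative y) (at x) \<and> 0 \<le> y" by blast
  qed
  then show ?thesis using above[of s] s by auto
qed (use c in simp)

locale ego_and_obstacle =
  E: regular_constraints eps n\<^sub>E F\<^sub>E + O: regular_constraints eps m Fo
  for eps :: real and n\<^sub>E m :: nat
    and F\<^sub>E :: "nat \<Rightarrow> real^'n \<Rightarrow> 'e::euclidean_space \<Rightarrow> real"
    and Fo :: "nat \<Rightarrow> real^'n \<Rightarrow> 'l::euclidean_space \<Rightarrow> real"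
begin

sublocale two_moving_convex_bodies "exp_sum_excess eps n\<^sub>E F\<^sub>E" "exp_sum_excess eps m Fo" ..

lemma overapprox_dist_eq_gap: "overapprox_dist eps n\<^sub>E F\<^sub>E m Fo p q = (gap (p, q))\<^sup>2 / 2"
  unfolding overapprox_dist_def Inf_half_squared_distance[symmetric]
    E.body_eq_overapprox O.body_eq_overapprox ..

lemma overapprox_dist_pos_iff_disjoint:
  "0 < overapprox_dist eps n\<^sub>E F\<^sub>E m Fo p q \<longleftrightarrow> overapprox eps n\<^sub>E F\<^sub>E p \<inter> overapprox eps m Fo q = {}"
  using gap_eq_0_iff_meet[of p q]
  by (auto simp: overapprox_dist_eq_gap E.body_eq_overapprox O.body_eq_overapprox)

lemma overapprox_dist_nonneg: "0 \<le> overapprox_dist eps n\<^sub>E F\<^sub>E m Fo p q"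
  by (simp add: overapprox_dist_eq_gap)

text \<open>The derivative vanishes wherever the distance does, because the distance has a minimum there.\<close>

lemma overapprox_dist_has_derivative:
  obtains D where
    "((\<lambda>pq. overapprox_dist eps n\<^sub>E F\<^sub>E m Fo (fst pq) (snd pq)) has_derivative D) (at (p, q))"
    "overapprox_dist eps n\<^sub>E F\<^sub>E m Fo p q = 0 \<Longrightarrow> D = (\<lambda>_. 0)"
proof (cases "gap (p, q) = 0")
  case True
  then show thesis
    using that[of "\<lambda>_. 0"] half_gap_squared_derivative_at_contact by (simp add: overapprox_dist_eq_gap)
next
  case False
  obtain D where "((\<lambda>pq. (gap pq)\<^sup>2 / 2) has_derivative D) (at (p, q))"
    using half_gap_squared_differentiable unfolding differentiable_def by blast
  then show thesis using that[of D] False by (simp add: overapprox_dist_eq_gap)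
qed

text \<open>At a contact the derivative is \<open>0\<close> but the admissibility inequality demands at least
  \<open>- \<alpha> (- R)\<close>, which is positive; so the distance stays positive before \<open>t\<^sub>1\<close>. At \<open>t\<^sub>1\<close>, where no
  inequality is given, \<open>class_K_barrier_positive_at_end\<close> applies with \<open>c = - R\<close>.\<close>

lemma overapprox_dist_remains_positive:
  fixes lE :: "real \<Rightarrow> 'e" and l dl :: "real \<Rightarrow> 'l" and P :: "'l \<Rightarrow> 'l" and R :: real
  defines "h \<equiv> \<lambda>p q. overapprox_dist eps n\<^sub>E F\<^sub>E m Fo p q - R"
  assumes R: "0 < R" and K: "extended_class_K \<alpha>"
    and P: "linear P" "\<And>v. P (P v) = P v" "\<And>p q. h p (P q) = h p q"
    and l: "\<And>t. t \<in> {t\<^sub>0..t\<^sub>1} \<Longrightarrow> (l has_vector_derivative dl t) (at t within {t\<^sub>0..t\<^sub>1})"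
    and lE: "\<And>t. t \<in> {t\<^sub>0..t\<^sub>1} \<Longrightarrow> (lE has_vector_derivative dlE t) (at t within {t\<^sub>0..t\<^sub>1})"
    and admissible: "\<And>t. t \<in> {t\<^sub>0..<t\<^sub>1} \<Longrightarrow> - \<alpha> (h (lE t) (l t)) \<le>
          frechet_derivative (\<lambda>p. h p (l t)) (at (lE t)) (dlE t)
        + frechet_derivative (\<lambda>q. h (lE t) q) (at (l t)) (P (dl t))"
    and t: "t\<^sub>0 < t\<^sub>1" "t \<in> {t\<^sub>0..t\<^sub>1}"
  shows "0 < overapprox_dist eps n\<^sub>E F\<^sub>E m Fo (lE t) (l t)"
proof -
  define \<phi> where "\<phi> t = h (lE t) (l t)" for t
  have rate: "\<exists>d. (\<phi> has_vector_derivative d) (at t within {t\<^sub>0..t\<^sub>1}) \<and>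
      (t < t\<^sub>1 \<longrightarrow> - \<alpha> (\<phi> t) \<le> d) \<and> (\<phi> t = - R \<longrightarrow> d = 0)" if t: "t \<in> {t\<^sub>0..t\<^sub>1}" for t
  proof -
    obtain D where D0: "((\<lambda>pq. overapprox_dist eps n\<^sub>E F\<^sub>E m Fo (fst pq) (snd pq)) has_derivative D) (at (lE t, l t))"
      and zero: "overapprox_dist eps n\<^sub>E F\<^sub>E m Fo (lE t) (l t) = 0 \<Longrightarrow> D = (\<lambda>_. 0)"
      using overapprox_dist_has_derivative by blast
    have D: "((\<lambda>pq. h (fst pq) (snd pq)) has_derivative D) (at (lE t, l t))"
      using has_derivative_diff[OF D0 has_derivative_const[of R]] by (simp add: h_def)
    have "((\<lambda>t. (lE t, l t)) has_vector_derivative (dlE t, dl t)) (at t within {t\<^sub>0..t\<^sub>1})"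
      using has_vector_derivative_Pair[OF lE[OF t] l[OF t]] .
    from vector_derivative_diff_chain_within[OF this has_derivative_at_withinI[OF D]]
    have rate: "(\<phi> has_vector_derivative D (dlE t, dl t)) (at t within {t\<^sub>0..t\<^sub>1})"
      by (simp add: o_def \<phi>_def[abs_def])
    have "D (dlE t, dl t) = D (dlE t, 0) + D (0, dl t)"
      using linear_add[OF has_derivative_linear[OF D], of "(dlE t, 0)" "(0, dl t)"] by simp
    also have "D (0, dl t) = D (0, P (dl t))"
      using derivative_factors_through_projection[OF partial_derivative_in_second[where \<phi> = h, OF D] P(1,2,3)]
      by simp
    also have "D (dlE t, 0) = frechet_derivative (\<lambda>p. h p (l t)) (at (lE t)) (dlE t)"
      using fun_cong[OF frechet_derivative_at[OF partial_derivative_in_first[where \<phi> = h, OF D]]] by simp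
    also have "D (0, P (dl t)) = frechet_derivative (\<lambda>q. h (lE t) q) (at (l t)) (P (dl t))"
      using fun_cong[OF frechet_derivative_at[OF partial_derivative_in_second[where \<phi> = h, OF D]]] by simp
    finally have "t < t\<^sub>1 \<longrightarrow> - \<alpha> (\<phi> t) \<le> D (dlE t, dl t)"
      using admissible[of t] t by (simp add: \<phi>_def)
    moreover have "\<phi> t = - R \<longrightarrow> D (dlE t, dl t) = 0"
      using zero by (simp add: \<phi>_def h_def)
    ultimately show ?thesis using rate by blast
  qed
  have above: "- R < \<phi> t" if t: "t \<in> {t\<^sub>0..<t\<^sub>1}" for t
  proof (rule ccontr)
    assume "\<not> - R < \<phi> t"
    then have eq: "\<phi> t = - R"
      using overapprox_dist_nonneg[of "lE t" "l t"] by (simp add: \<phi>_def h_def)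
    then have "0 \<le> \<alpha> (- R)" using rate[of t] t by auto
    moreover have "\<alpha> (- R) < \<alpha> 0"
      using R K strict_monoD[of \<alpha> "- R" 0] by (simp add: extended_class_K_def)
    ultimately show False using K by (simp add: extended_class_K_def)
  qed
  have "- R < \<phi> t\<^sub>1"
  proof (rule class_K_barrier_positive_at_end[OF K _ \<open>t\<^sub>0 < t\<^sub>1\<close> _ above])
    show "continuous_on {t\<^sub>0..t\<^sub>1} \<phi>"
      unfolding continuous_on_eq_continuous_within
      using rate has_vector_derivative_continuous by blast
    show "\<exists>d. (\<phi> has_vector_derivative d) (at t within {t\<^sub>0..t\<^sub>1}) \<and> - \<alpha> (\<phi> t) \<le> d"
      if "t \<in> {t\<^sub>0..<t\<^sub>1}" for t
      using rate[of t] that by auto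
  qed (use R in simp)
  then have "- R < \<phi> t" using above[of t] t by (cases "t = t\<^sub>1") auto
  then show ?thesis by (simp add: \<phi>_def h_def)
qed

end

theorem theorem3:
  fixes S :: "real^'m \<Rightarrow> (real^'n) set"
    and S\<^sub>E :: "real^'e \<Rightarrow> (real^'n) set"
    and Sbar :: "'j::finite \<Rightarrow> real^'m \<Rightarrow> (real^'n) set"
    and own :: "'m \<Rightarrow> 'j"
    and n\<^sub>E :: nat and F\<^sub>E :: "nat \<Rightarrow> real^'n \<Rightarrow> real^'e \<Rightarrow> real"
    and n :: "'j \<Rightarrow> nat" and F :: "'j \<Rightarrow> nat \<Rightarrow> real^'n \<Rightarrow> real^'m \<Rightarrow> real"
    and f :: "real^'e \<Rightarrow> real^'e" and g :: "real^'e \<Rightarrow> real^'p^'e"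
    and \<alpha> :: "'j \<Rightarrow> real \<Rightarrow> real"
    and eps R t\<^sub>0 t\<^sub>1 :: real
    and lE :: "real \<Rightarrow> real^'e"
    and l dl :: "real \<Rightarrow> real^'m"
    and u :: "real^'e \<Rightarrow> real^'p"
  assumes "eps > 0" and "R > 0"
    and "standard_conditions S\<^sub>E n\<^sub>E F\<^sub>E"
    and "full_column_rank n\<^sub>E F\<^sub>E"
    and "\<And>j. standard_conditions (Sbar j) (n j) (F j)"
    and "\<And>j. full_column_rank (n j) (F j)"
    and "\<And>j k x m. k \<in> {1..n j} \<Longrightarrow> F j k x m = F j k x (block own j m)"
    and "\<And>m. - S m \<subseteq> (\<Union>j. closure (Sbar j m))"
    and "loc_lipschitz f" and "loc_lipschitz g"
    and "\<And>j. loc_lipschitz (\<alpha> j)" and "\<And>j. extended_class_K (\<alpha> j)"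
    and "\<And>t. t \<in> {t\<^sub>0..t\<^sub>1} \<Longrightarrow> (l has_vector_derivative dl t) (at t within {t\<^sub>0..t\<^sub>1})"
    and "\<And>t. t \<in> {t\<^sub>0..t\<^sub>1} \<Longrightarrow>
           (lE has_vector_derivative (f (lE t) + g (lE t) *v u (lE t))) (at t within {t\<^sub>0..t\<^sub>1})"
    and "\<exists>L. L-lipschitz_on UNIV u"
    and "\<And>t. t \<in> {t\<^sub>0..<t\<^sub>1} \<Longrightarrow>
           u (lE t) \<in> admissible_controls own (barrier eps R n\<^sub>E F\<^sub>E n F) f g \<alpha> (lE t) (l t) (dl t)"
    and "S\<^sub>E (lE t\<^sub>0) \<inter> (- S (l t\<^sub>0)) = {}"
  shows "\<forall>t\<in>{t\<^sub>0..t\<^sub>1}. S\<^sub>E (lE t) \<inter> (- S (l t)) = {}"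
proof (cases "t\<^sub>0 < t\<^sub>1")
  case True
  show ?thesis
  proof
    fix t assume t: "t \<in> {t\<^sub>0..t\<^sub>1}"
    have disjoint: "S\<^sub>E (lE t) \<inter> closure (Sbar j (l t)) = {}" for j
    proof -
      interpret ego_and_obstacle eps n\<^sub>E "n j" F\<^sub>E "F j"
        unfolding ego_and_obstacle_def
        by (intro conjI regular_constraints_if_standard_conditions[OF assms(1) assms(3,4)]
            regular_constraints_if_standard_conditions[OF assms(1) assms(5,6)])
      have same: "overapprox_dist eps n\<^sub>E F\<^sub>E (n j) (F j) p (block own j q)
          = overapprox_dist eps n\<^sub>E F\<^sub>E (n j) (F j) p q" for p q
      proof -
        have "exp_sum_excess eps (n j) (F j) x (block own j q) = exp_sum_excess eps (n j) (F j) x q" for x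
          unfolding exp_sum_excess_def by (simp add: assms(7)[symmetric])
        then show ?thesis
          by (simp add: overapprox_dist_def overapprox_eq_sublevel[OF assms(1)])
      qed
      have "0 < overapprox_dist eps n\<^sub>E F\<^sub>E (n j) (F j) (lE t) (l t)"
      proof (rule overapprox_dist_remains_positive[OF assms(2) assms(12)[of j]
            linear_block[of own j] block_idem _ assms(13,14) _ True t])
        fix t assume "t \<in> {t\<^sub>0..<t\<^sub>1}"
        from assms(16)[OF this, unfolded admissible_controls_def barrier_def mem_Collect_eq, rule_format, of j]
        show "- \<alpha> j (overapprox_dist eps n\<^sub>E F\<^sub>E (n j) (F j) (lE t) (l t) - R) \<le>
            frechet_derivative (\<lambda>p. overapprox_dist eps n\<^sub>E F\<^sub>E (n j) (F j) p (l t) - R)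
              (at (lE t)) (f (lE t) + g (lE t) *v u (lE t))
          + frechet_derivative (\<lambda>q. overapprox_dist eps n\<^sub>E F\<^sub>E (n j) (F j) (lE t) q - R)
              (at (l t)) (block own j (dl t))"
          .
      qed (simp_all add: same)
      then have "overapprox eps n\<^sub>E F\<^sub>E (lE t) \<inter> overapprox eps (n j) (F j) (l t) = {}"
        by (simp add: overapprox_dist_pos_iff_disjoint)
      moreover have "S\<^sub>E (lE t) \<subseteq> overapprox eps n\<^sub>E F\<^sub>E (lE t)"
      proof -
        have "S\<^sub>E (lE t) = {x. \<forall>k\<in>{1..n\<^sub>E}. F\<^sub>E k x (lE t) \<le> 0}"
          using assms(3) unfolding standard_conditions_def by (elim conjE) simp
        then show ?thesis using overapprox_superset[OF assms(1)] by simp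
      qed
      moreover have "Sbar j (l t) \<subseteq> overapprox eps (n j) (F j) (l t)"
      proof -
        have "Sbar j (l t) = {x. \<forall>k\<in>{1..n j}. F j k x (l t) \<le> 0}"
          using assms(5)[of j] unfolding standard_conditions_def by (elim conjE) simp
        then show ?thesis using overapprox_superset[OF assms(1)] by simp
      qed
      moreover have "closure (Sbar j (l t)) = Sbar j (l t)"
      proof -
        have "compact (Sbar j (l t))"
          using assms(5)[of j] unfolding standard_conditions_def by (elim conjE) simp
        then show ?thesis by (intro closure_closed compact_imp_closed)
      qed
      ultimately show ?thesis by blast
    qed
    then show "S\<^sub>E (lE t) \<inter> - S (l t) = {}" using assms(8)[of "l t"] by blast
  qed
next
  case False
  show ?thesis
  proof
    fix t assume "t \<in> {t\<^sub>0..t\<^sub>1}"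
    then have "t = t\<^sub>0" using False by simp
    then show "S\<^sub>E (lE t) \<inter> - S (l t) = {}" using assms(17) by simp
  qed
qed

end
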